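(* Let $r\ge 2$ be an integer and let $\alpha\in[1,2r-1]$ be a real number. Then there exists a subgroup $H\le F_r$ (not necessarily finitely generated) whose growth rate within $F_r$ equals $\alpha$, that is, $\omega_{F_r}(H)=\alpha$.
   Context: $F_r$ is the free group of rank $r$ with a fixed free basis $S$, and $\|g\|_S$ is the word length of $g\in F_r$ with respect to $S$ (the length of the reduced word in $S\cup S^{-1}$ representing $g$). For a subgroup $H\le F_r$, let $f_{(H,F_r,S)}(n)=\#\{h\in H:\|h\|_S=n\}$. The growth rate of $H$ within $F_r$ is $\omega_{F_r}(H)=\limsup_{n\to\infty} f_{(H,F_r,S)}(n)^{1/n}$. *)

theory Defs
  imports "HOL-Algebra.Group" "HOL-Library.Liminf_Limsup" "HOL-Library.Extended_Real"
begin

text \<open>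
  The free group on a set of generators, realised on reduced words. The letter \<open>(s, True)\<close> is the
  generator \<open>s\<close>, and \<open>(s, False)\<close> is its formal inverse.
\<close>

type_synonym 'a letter = "'a \<times> bool"

definition inv_letter :: "'a letter \<Rightarrow> 'a letter" where
  "inv_letter x = (fst x, \<not> snd x)"

definition reduced :: "'a letter list \<Rightarrow> bool" where
  "reduced w \<longleftrightarrow> successively (\<lambda>x y. y \<noteq> inv_letter x) w"

fun push_letter :: "'a letter \<Rightarrow> 'a letter list \<Rightarrow> 'a letter list" where
  "push_letter x [] = [x]"
| "push_letter x (y # w) = (if y = inv_letter x then w else x # y # w)"

definition reduce_word :: "'a letter list \<Rightarrow> 'a letter list" where
  "reduce_word w = foldr push_letter w []"

definition free_group :: "'a set \<Rightarrow> 'a letter list monoid" where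
  "free_group S =
    \<lparr> carrier = {w. reduced w \<and> fst ` set w \<subseteq> S},
      mult = (\<lambda>u v. reduce_word (u @ v)),
      one = [] \<rparr>"

text \<open>
  Elements of \<open>free_group S\<close> are themselves reduced words, so the word length with respect to the
  basis \<open>S\<close> is the length of the list.
\<close>

definition word_length :: "'a letter list \<Rightarrow> nat" where
  "word_length g = length g"

definition growth_fun :: "'a letter list set \<Rightarrow> nat \<Rightarrow> nat" where
  "growth_fun H n = card {h \<in> H. word_length h = n}"

text \<open>
  The limit superior is taken in the extended reals; \<open>root 0\<close> is constantly \<open>0\<close>, so the term at
  \<open>n = 0\<close> is a dummy value and does not influence it.
\<close>

definition growth_rate :: "'a letter list set \<Rightarrow> ereal" where
  "growth_rate H = limsup (\<lambda>n. ereal (root n (real (growth_fun H n))))"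

lemma inv_letter_inv_letter [simp]: "inv_letter (inv_letter x) = x"
  by (simp add: inv_letter_def)

lemma fst_inv_letter [simp]: "fst (inv_letter x) = fst x"
  by (simp add: inv_letter_def)

lemma reduced_push: "reduced w \<Longrightarrow> reduced (push_letter x w)"
  by (cases w) (auto simp: reduced_def successively_Cons)

lemma push_inv_push:
  assumes "reduced w"
  shows "push_letter x (push_letter (inv_letter x) w) = w"
  using assms
proof (cases w)
  case (Cons y v)
  then show ?thesis using assms
    by (cases v) (auto simp: reduced_def)
qed simp

lemma reduced_foldr_push: "reduced w \<Longrightarrow> reduced (foldr push_letter u w)"
  by (induction u) (auto intro: reduced_push)

lemma reduced_reduce_word: "reduced (reduce_word w)"
  unfolding reduce_word_def by (rule reduced_foldr_push) (simp add: reduced_def)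

lemma reduce_word_id: "reduced w \<Longrightarrow> reduce_word w = w"
proof (induction w)
  case (Cons x w)
  then show ?case
    by (cases w) (auto simp: reduce_word_def reduced_def)
qed (simp add: reduce_word_def)

lemma set_push: "set (push_letter x w) \<subseteq> insert x (set w)"
  by (cases w) auto

lemma set_reduce_word: "set (reduce_word w) \<subseteq> set w"
proof (induction w)
  case (Cons x w)
  then show ?case
    using set_push[of x "reduce_word w"] by (auto simp: reduce_word_def)
qed (simp add: reduce_word_def)

lemma foldr_push_reduce_word:
  "reduced w \<Longrightarrow> foldr push_letter (reduce_word u) w = foldr push_letter u w"
proof (induction u)
  case (Cons x u)
  have *: "foldr push_letter (push_letter x v) w = push_letter x (foldr push_letter v w)" for v
    using push_inv_push[OF reduced_foldr_push[OF Cons.prems]] by (cases v) auto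
  show ?case using Cons * by (simp add: reduce_word_def)
qed (simp add: reduce_word_def)

lemma reduce_word_append: "reduce_word (u @ v) = foldr push_letter u (reduce_word v)"
  by (simp add: reduce_word_def)

lemma reduce_word_append_left: "reduce_word (reduce_word u @ v) = reduce_word (u @ v)"
  by (simp add: reduce_word_append foldr_push_reduce_word reduced_reduce_word)

lemma reduce_word_append_right: "reduce_word (u @ reduce_word v) = reduce_word (u @ v)"
  by (simp add: reduce_word_append reduce_word_id reduced_reduce_word)

lemma reduce_word_inverse: "reduce_word (rev (map inv_letter w) @ w) = []"
proof (induction w)
  case (Cons x w)
  have "push_letter (inv_letter x) (push_letter x (reduce_word w)) = reduce_word w"
    using push_inv_push[OF reduced_reduce_word, of "inv_letter x" w] by simp
  then show ?case using Cons by (simp add: reduce_word_def)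
qed (simp add: reduce_word_def)

lemma group_free_group: "group (free_group S)"
proof (rule groupI)
  fix x y z
  assume x: "x \<in> carrier (free_group S)" and y: "y \<in> carrier (free_group S)"
  show "x \<otimes>\<^bsub>free_group S\<^esub> y \<in> carrier (free_group S)"
    using x y set_reduce_word[of "x @ y"]
    by (fastforce simp: free_group_def reduced_reduce_word)
  show "x \<otimes>\<^bsub>free_group S\<^esub> y \<otimes>\<^bsub>free_group S\<^esub> z =
        x \<otimes>\<^bsub>free_group S\<^esub> (y \<otimes>\<^bsub>free_group S\<^esub> z)"
    by (simp add: free_group_def reduce_word_append_left reduce_word_append_right)
next
  fix x assume x: "x \<in> carrier (free_group S)"
  then show "\<one>\<^bsub>free_group S\<^esub> \<otimes>\<^bsub>free_group S\<^esub> x = x"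
    by (simp add: free_group_def reduce_word_id)
  let ?y = "reduce_word (rev (map inv_letter x))"
  have "?y \<in> carrier (free_group S)"
    using x set_reduce_word[of "rev (map inv_letter x)"]
    by (fastforce simp: free_group_def reduced_reduce_word)
  moreover have "?y \<otimes>\<^bsub>free_group S\<^esub> x = \<one>\<^bsub>free_group S\<^esub>"
    by (simp add: free_group_def reduce_word_append_left reduce_word_inverse)
  ultimately show "\<exists>y\<in>carrier (free_group S). y \<otimes>\<^bsub>free_group S\<^esub> x = \<one>\<^bsub>free_group S\<^esub>"
    by blast
qed (simp add: free_group_def reduced_def)

end

theory Submission
  imports Defs
begin

text \<open>
  Write \<open>q = 2 r - 1\<close>. Replacing every letter by its \<open>L\<close>-th power turns growth rate
  \<open>\<beta>\<close> into \<open>\<beta> ^ (1 / L)\<close>, so, apart from the whole group and a cyclic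
  group, only \<open>sqrt q < \<alpha> < q\<close> has to be realised. Here the growth of \<open>H\<close> is controlled
  by the number \<open>b n\<close> of unreduced words of length \<open>n\<close> representing elements of \<open>H\<close>
  (Grigorchuk's cogrowth formula): the growth rate is at most \<open>\<alpha>\<close> iff
  \<open>b n \<le> R ^ n\<close> for all \<open>n\<close>, where \<open>R = \<alpha> + q / \<alpha>\<close>. The latter condition has no
  unspecified constant, because \<open>b\<close> is supermultiplicative, and therefore survives unions of
  chains. By Zorn's lemma there is a maximal Stallings graph \<open>E\<close> satisfying it, among graphs on
  the integers in which one generator acts as the translation and the other edges lie in finite
  blocks, with cycles that become longer and longer far out. If the growth rate were smaller than
  \<open>\<alpha>\<close>, then a further edge between two distant vertices of a far block would change it so
  little that maximality excludes such an edge; hence far blocks miss only a bounded number of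
  edges compared to their size, and the Rayleigh quotient of their indicator function
  forces \<open>R \<ge> q + 1\<close>, which contradicts \<open>1 < \<alpha> < q\<close>.
\<close>

section \<open>Reduced words\<close>

definition inv_word :: "'a letter list \<Rightarrow> 'a letter list" where
  "inv_word w = rev (map inv_letter w)"

lemma inv_word_Nil [simp]: "inv_word [] = []"
  by (simp add: inv_word_def)

lemma inv_word_Cons: "inv_word (l # w) = inv_word w @ [inv_letter l]"
  by (simp add: inv_word_def)

lemma inv_word_inv_word [simp]: "inv_word (inv_word w) = w"
  by (simp add: inv_word_def rev_map comp_def)

lemma length_inv_word [simp]: "length (inv_word w) = length w"
  by (simp add: inv_word_def)

lemma inv_letter_eq_iff: "inv_letter l = m \<longleftrightarrow> l = inv_letter m"
  by auto

lemma inv_letter_neq [simp]: "inv_letter l \<noteq> l" "l \<noteq> inv_letter l"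
  by (auto simp: inv_letter_def prod_eq_iff)

lemma reduced_Nil [simp]: "reduced []"
  by (simp add: reduced_def)

lemma reduced_Cons: "reduced (l # w) \<longleftrightarrow> reduced w \<and> (w = [] \<or> hd w \<noteq> inv_letter l)"
  by (auto simp: reduced_def successively_Cons)

lemma reduced_appendD: "reduced (u @ v) \<Longrightarrow> reduced u \<and> reduced v"
  by (auto simp: reduced_def successively_append_iff)

lemma reduced_inv_word: "reduced w \<Longrightarrow> reduced (inv_word w)"
  unfolding reduced_def inv_word_def successively_rev successively_map
  by (elim successively_mono) (auto simp: inv_letter_eq_iff)

lemma reduce_word_inverse_right: "reduce_word (w @ inv_word w) = []"
  using reduce_word_inverse[of "inv_word w"] by (simp flip: inv_word_def)

text \<open>Uniqueness of inverses, played out on words: the trivial word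
  \<open>?u @ inv_word ?u\<close> is appended, \<open>?u\<close> is traded for \<open>w\<close>, and
  \<open>inv_word w @ w\<close> cancels.\<close>

lemma reduce_word_inv_word: "reduce_word (inv_word w) = inv_word (reduce_word w)"
proof -
  let ?u = "reduce_word w"
  have "reduce_word (inv_word w) = reduce_word (inv_word w @ reduce_word (?u @ inv_word ?u))"
    by (simp add: reduce_word_inverse_right)
  also have "\<dots> = reduce_word (inv_word w @ ?u @ inv_word ?u)"
    by (rule reduce_word_append_right)
  also have "\<dots> = reduce_word (inv_word w @ reduce_word (reduce_word w @ inv_word ?u))"
    by (simp add: reduce_word_append_right)
  also have "\<dots> = reduce_word ((inv_word w @ w) @ inv_word ?u)"
    by (simp add: reduce_word_append_left reduce_word_append_right)
  also have "\<dots> = reduce_word (reduce_word (inv_word w @ w) @ inv_word ?u)"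
    by (simp only: reduce_word_append_left)
  also have "\<dots> = inv_word ?u"
    using reduce_word_inverse[of w]
    by (simp add: reduce_word_id reduced_inv_word reduced_reduce_word flip: inv_word_def)
  finally show ?thesis .
qed

lemma reduce_word_Cons: "reduce_word (l # w) = push_letter l (reduce_word w)"
  by (simp add: reduce_word_def)

lemma reduce_word_Nil [simp]: "reduce_word [] = []"
  by (simp add: reduce_word_def)

lemma push_letter_eq_iff:
  assumes "reduced u" "reduced w"
  shows "push_letter l u = w \<longleftrightarrow> u = push_letter (inv_letter l) w"
  using push_inv_push[OF assms(1), of "inv_letter l"] push_inv_push[OF assms(2), of l] by auto

lemma length_reduce_word: "length (reduce_word w) \<le> length w"
proof (induction w)
  case (Cons l w)
  have "length (push_letter l u) \<le> Suc (length u)" for u :: "'a letter list"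
    by (cases u) auto
  then show ?case
    using Cons le_trans by (fastforce simp: reduce_word_Cons)
qed simp

section \<open>Labelled graphs\<close>

definition edge :: "('v \<times> 'a \<times> 'v) set \<Rightarrow> 'v \<Rightarrow> 'a letter \<Rightarrow> 'v \<Rightarrow> bool" where
  "edge E x l y \<longleftrightarrow> (if snd l then (x, fst l, y) \<in> E else (y, fst l, x) \<in> E)"

fun walk :: "('v \<times> 'a \<times> 'v) set \<Rightarrow> 'v \<Rightarrow> 'a letter list \<Rightarrow> 'v \<Rightarrow> bool" where
  "walk E x [] y \<longleftrightarrow> x = y"
| "walk E x (l # w) y \<longleftrightarrow> (\<exists>v. edge E x l v \<and> walk E v w y)"

text \<open>Stallings' condition. Since \<open>l\<close> may be an inverse letter, it restricts
  incoming edges as much as outgoing ones.\<close>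

definition folded :: "('v \<times> 'a \<times> 'v) set \<Rightarrow> bool" where
  "folded E \<longleftrightarrow> (\<forall>x l y z. edge E x l y \<longrightarrow> edge E x l z \<longrightarrow> y = z)"

lemma foldedD: "folded E \<Longrightarrow> edge E x l y \<Longrightarrow> edge E x l z \<Longrightarrow> y = z"
  unfolding folded_def by blast

lemma folded_iff:
  "folded E \<longleftrightarrow> (\<forall>x s y z. (x, s, y) \<in> E \<longrightarrow> (x, s, z) \<in> E \<longrightarrow> y = z) \<and>
     (\<forall>x s y z. (y, s, x) \<in> E \<longrightarrow> (z, s, x) \<in> E \<longrightarrow> y = z)" (is "_ \<longleftrightarrow> ?out \<and> ?in")
proof
  assume E: "folded E"
  show "?out \<and> ?in"
  proof (intro conjI allI impI)
    show "y = z" if "(x, s, y) \<in> E" "(x, s, z) \<in> E" for x s y z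
      using foldedD[OF E, of x "(s, True)"] that by (simp add: edge_def)
    show "y = z" if "(y, s, x) \<in> E" "(z, s, x) \<in> E" for x s y z
      using foldedD[OF E, of x "(s, False)"] that by (simp add: edge_def)
  qed
next
  assume "?out \<and> ?in"
  then show "folded E"
    unfolding folded_def edge_def by (metis (full_types))
qed

lemma edge_inv_letter: "edge E x (inv_letter l) y \<longleftrightarrow> edge E y l x"
  by (auto simp: edge_def inv_letter_def)

lemma edge_mono: "edge E x l y \<Longrightarrow> E \<subseteq> F \<Longrightarrow> edge F x l y"
  by (auto simp: edge_def split: if_splits)

lemma walk_mono: "walk E x w y \<Longrightarrow> E \<subseteq> F \<Longrightarrow> walk F x w y"
  by (induction w arbitrary: x) (auto dest: edge_mono)

lemma walk_append: "walk E x (u @ v) y \<longleftrightarrow> (\<exists>z. walk E x u z \<and> walk E z v y)"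
  by (induction u arbitrary: x) auto

lemma walk_inv_word: "walk E x (inv_word w) y \<longleftrightarrow> walk E y w x"
proof (induction w arbitrary: x y)
  case (Cons l w)
  then show ?case by (auto simp: inv_word_Cons walk_append edge_inv_letter)
qed auto

lemma walk_det: "folded E \<Longrightarrow> walk E x w y \<Longrightarrow> walk E x w z \<Longrightarrow> y = z"
  by (induction w arbitrary: x) (auto dest: foldedD)

lemma walk_push:
  assumes "folded E" "edge E x l v" "walk E v w y"
  shows "walk E x (push_letter l w) y"
proof (cases w)
  case (Cons m u)
  show ?thesis
  proof (cases "m = inv_letter l")
    case True
    then obtain v' where "edge E v (inv_letter l) v'" "walk E v' u y"
      using assms(3) Cons by auto
    moreover have "v' = x"
      using assms(1,2) calculation(1) edge_inv_letter foldedD by metis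
    ultimately show ?thesis using Cons True by simp
  qed (use assms Cons in auto)
qed (use assms in auto)

lemma walk_foldr_push:
  "folded E \<Longrightarrow> walk E x u v \<Longrightarrow> walk E v w y \<Longrightarrow> walk E x (foldr push_letter u w) y"
  by (induction u arbitrary: x) (auto intro: walk_push)

lemma walk_reduce_word: "folded E \<Longrightarrow> walk E x w y \<Longrightarrow> walk E x (reduce_word w) y"
  unfolding reduce_word_def by (erule walk_foldr_push) auto

lemma folded_insert:
  assumes "folded E" "\<not> (\<exists>v. edge E x (s, True) v)" "\<not> (\<exists>v. edge E y (s, False) v)"
  shows "folded (insert (x, s, y) E)"
  using assms unfolding folded_iff by (auto simp: edge_def)

lemma folded_Union_chain:
  assumes "subset.chain \<A> \<C>" "\<And>E. E \<in> \<C> \<Longrightarrow> folded E"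
  shows "folded (\<Union>\<C>)"
  unfolding folded_def
proof (intro allI impI)
  fix x l y z assume "edge (\<Union>\<C>) x l y" "edge (\<Union>\<C>) x l z"
  then obtain E F where "E \<in> \<C>" "edge E x l y" "F \<in> \<C>" "edge F x l z"
    by (auto simp: edge_def split: if_splits)
  moreover from this have "E \<subseteq> F \<or> F \<subseteq> E"
    using assms(1) by (auto simp: subset.chain_def)
  ultimately show "y = z"
    using assms(2) by (meson edge_mono foldedD)
qed

lemma walk_Union_chain:
  assumes "subset.chain \<A> \<C>" "\<C> \<noteq> {}" "walk (\<Union>\<C>) x w y"
  shows "\<exists>E\<in>\<C>. walk E x w y"
  using assms(3)
proof (induction w arbitrary: x)
  case Nil
  then show ?case using assms(2) by auto
next
  case (Cons l w)
  then obtain v where "walk (\<Union>\<C>) v w y" "edge (\<Union>\<C>) x l v" by auto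
  moreover from this Cons.IH obtain E where "E \<in> \<C>" "walk E v w y" by blast
  moreover from \<open>edge (\<Union>\<C>) x l v\<close> obtain F where "F \<in> \<C>" "edge F x l v"
    by (auto simp: edge_def split: if_splits)
  moreover from calculation have "E \<subseteq> F \<or> F \<subseteq> E"
    using assms(1) by (auto simp: subset.chain_def)
  ultimately show ?case
    by (meson edge_mono walk.simps(2) walk_mono)
qed

text \<open>\<open>stab S E x x\<close> is the subgroup with Stallings graph \<open>E\<close> and base vertex \<open>x\<close>.\<close>

definition stab :: "'a set \<Rightarrow> ('v \<times> 'a \<times> 'v) set \<Rightarrow> 'v \<Rightarrow> 'v \<Rightarrow> 'a letter list set" where
  "stab S E x y = {w. reduced w \<and> set w \<subseteq> S \<times> UNIV \<and> walk E x w y}"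

lemma fst_set_subset_iff: "fst ` set w \<subseteq> S \<longleftrightarrow> set w \<subseteq> S \<times> UNIV"
  by auto

lemma set_inv_word: "set (inv_word w) \<subseteq> S \<times> UNIV \<longleftrightarrow> set w \<subseteq> S \<times> UNIV"
  by (fastforce simp: inv_word_def inv_letter_def)

lemma inv_free_group:
  assumes "w \<in> carrier (free_group S)"
  shows "inv\<^bsub>free_group S\<^esub> w = inv_word w"
proof -
  interpret group "free_group S" by (rule group_free_group)
  show ?thesis
  proof (rule inv_equality)
    show "inv_word w \<otimes>\<^bsub>free_group S\<^esub> w = \<one>\<^bsub>free_group S\<^esub>"
      using reduce_word_inverse[of w] by (simp add: free_group_def inv_word_def)
    show "inv_word w \<in> carrier (free_group S)"
      using assms by (simp add: free_group_def reduced_inv_word fst_set_subset_iff set_inv_word)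
  qed (fact assms)
qed

lemma subgroup_stab:
  assumes "folded E"
  shows "subgroup (stab S E x x) (free_group S)"
proof -
  interpret group "free_group S" by (rule group_free_group)
  have sub: "stab S E x x \<subseteq> carrier (free_group S)"
    by (auto simp: stab_def free_group_def)
  show ?thesis
  proof (rule subgroupI)
    show "stab S E x x \<noteq> {}"
      by (auto simp: stab_def intro!: exI[of _ "[]"])
    show "inv\<^bsub>free_group S\<^esub> u \<in> stab S E x x" if "u \<in> stab S E x x" for u
      using that sub by (subst inv_free_group)
        (auto simp: stab_def reduced_inv_word set_inv_word walk_inv_word)
    show "u \<otimes>\<^bsub>free_group S\<^esub> v \<in> stab S E x x" if "u \<in> stab S E x x" "v \<in> stab S E x x" for u v
    proof -
      have "walk E x (reduce_word (u @ v)) x"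
        using that assms by (intro walk_reduce_word) (auto simp: stab_def walk_append)
      moreover have "set (reduce_word (u @ v)) \<subseteq> S \<times> UNIV"
        using that set_reduce_word[of "u @ v"] by (auto simp: stab_def)
      ultimately show ?thesis
        by (simp add: stab_def free_group_def reduced_reduce_word)
    qed
  qed (fact sub)
qed

section \<open>Counting words by their reduction\<close>

locale free_alphabet =
  fixes S :: "'a set"
  assumes finite_S: "finite S" and nonempty_S: "S \<noteq> {}"
begin

text \<open>The Cayley tree of the free group is regular of degree \<open>q + 1\<close>.\<close>

definition q :: real where
  "q = 2 * real (card S) - 1"

abbreviation letters :: "'a letter set" where
  "letters \<equiv> S \<times> UNIV"

definition words :: "nat \<Rightarrow> 'a letter list set" where
  "words n = {w. set w \<subseteq> letters \<and> length w = n}"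

text \<open>The eigenvalue of the function \<open>z ^ length w\<close> under the adjacency operator
  of the Cayley tree, away from the root.\<close>

definition rate :: "real \<Rightarrow> real" where
  "rate z = 1 / z + q * z"

text \<open>In the Cayley tree, these are the walks of length \<open>n\<close> from the root to
  \<open>w\<close>, backtracking allowed.\<close>

definition reductions :: "nat \<Rightarrow> 'a letter list \<Rightarrow> 'a letter list set" where
  "reductions n w = {v \<in> words n. reduce_word v = w}"

lemma finite_letters: "finite letters"
  using finite_S by simp

lemma card_letters: "card letters = 2 * card S"
  by (simp add: card_cartesian_product)

lemma q_ge_1: "q \<ge> 1"
proof -
  have "card S \<ge> 1"
    using finite_S nonempty_S by (simp add: Suc_leI card_gt_0_iff)
  then show ?thesis by (simp add: q_def)
qed

lemma finite_words: "finite (words n)"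
  using finite_lists_length_eq[OF finite_letters] by (simp add: words_def)

lemma card_words: "real (card (words n)) = (q + 1) ^ n"
  using card_lists_length_eq[OF finite_letters, of n]
  by (simp add: words_def card_letters q_def)

lemma finite_reductions [simp]: "finite (reductions n w)"
  using finite_words by (simp add: reductions_def)

lemma inv_letter_in_letters [simp]: "inv_letter l \<in> letters \<longleftrightarrow> l \<in> letters"
  by (cases l) (simp add: inv_letter_def)

lemma bij_inv_letter: "bij_betw inv_letter letters letters"
  by (rule bij_betwI[where g = inv_letter]) auto

lemma set_push_letter_subset:
  "l \<in> letters \<Longrightarrow> set w \<subseteq> letters \<Longrightarrow> set (push_letter l w) \<subseteq> letters"
  using set_push[of l w] by blast

lemma set_reduce_word_subset: "set w \<subseteq> letters \<Longrightarrow> set (reduce_word w) \<subseteq> letters"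
  using set_reduce_word by blast

text \<open>Pushing a letter moves to a neighbour in the Cayley tree: exactly one neighbour of a
  nonempty word is nearer to the root, the other \<open>q\<close> are farther.\<close>

lemma sum_length_push:
  fixes \<phi> :: "nat \<Rightarrow> real"
  assumes "set w \<subseteq> letters"
  shows "(\<Sum>l\<in>letters. \<phi> (length (push_letter l w))) =
    (if w = [] then (q + 1) * \<phi> 1 else \<phi> (length w - 1) + q * \<phi> (Suc (length w)))"
proof (cases w)
  case Nil
  then show ?thesis
    using card_letters by (simp add: q_def)
next
  case (Cons m u)
  have m: "inv_letter m \<in> letters" using assms Cons by simp
  have "(\<Sum>l\<in>letters. \<phi> (length (push_letter l w))) =
      \<phi> (length u) + (\<Sum>l\<in>letters - {inv_letter m}. \<phi> (length (push_letter l w)))"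
    using m finite_letters Cons by (subst sum.remove[of _ "inv_letter m"]) auto
  also have "(\<Sum>l\<in>letters - {inv_letter m}. \<phi> (length (push_letter l w))) =
      (\<Sum>l\<in>letters - {inv_letter m}. \<phi> (Suc (length w)))"
    by (rule sum.cong) (auto simp: Cons inv_letter_def)
  also have "\<dots> = q * \<phi> (Suc (length w))"
    using m finite_letters q_ge_1 card_letters by (simp add: q_def of_nat_diff card_Diff_singleton)
  finally show ?thesis using Cons by simp
qed

lemma card_reductions_0: "card (reductions 0 w) = (if w = [] then 1 else 0)"
proof -
  have "reductions 0 w = (if w = [] then {[]} else {})"
    by (auto simp: reductions_def words_def)
  then show ?thesis by simp
qed

lemma card_reductions_Suc:
  assumes "reduced w"
  shows "card (reductions (Suc n) w) = (\<Sum>l\<in>letters. card (reductions n (push_letter l w)))"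
proof -
  have "reductions (Suc n) w =
      (\<Union>l\<in>letters. (#) l ` reductions n (push_letter (inv_letter l) w))"
  proof (intro equalityI subsetI)
    fix v assume "v \<in> reductions (Suc n) w"
    then obtain l u where "v = l # u" "l \<in> letters" "u \<in> words n" "push_letter l (reduce_word u) = w"
      by (cases v) (auto simp: reductions_def words_def reduce_word_Cons)
    then show "v \<in> (\<Union>l\<in>letters. (#) l ` reductions n (push_letter (inv_letter l) w))"
      using push_letter_eq_iff[OF reduced_reduce_word assms, of l u] by (auto simp: reductions_def)
  next
    fix u assume "u \<in> (\<Union>l\<in>letters. (#) l ` reductions n (push_letter (inv_letter l) w))"
    then obtain l v where "u = l # v" "l \<in> letters" "v \<in> reductions n (push_letter (inv_letter l) w)"
      by blast
    then show "u \<in> reductions (Suc n) w"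
      using push_letter_eq_iff[OF reduced_reduce_word assms, of l v]
      by (auto simp: reductions_def words_def reduce_word_Cons)
  qed
  then have "card (reductions (Suc n) w) =
      (\<Sum>l\<in>letters. card ((#) l ` reductions n (push_letter (inv_letter l) w)))"
    using finite_letters by (subst card_UN_disjoint[symmetric]) auto
  also have "\<dots> = (\<Sum>l\<in>letters. card (reductions n (push_letter (inv_letter l) w)))"
    by (simp add: card_image)
  also have "\<dots> = (\<Sum>l\<in>letters. card (reductions n (push_letter l w)))"
    by (rule sum.reindex_bij_betw[OF bij_inv_letter])
  finally show ?thesis .
qed

lemma rate_pos: "z > 0 \<Longrightarrow> rate z > 0"
  using q_ge_1 by (simp add: rate_def add_pos_nonneg)

text \<open>The difference factors with \<open>1 - q * z * y\<close>. In this form \<open>y\<close>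
  may even lie beyond the minimum of \<open>rate\<close> at \<open>1 / sqrt q\<close>, which is used
  below.\<close>

lemma rate_strict_antimono:
  assumes "0 < z" "z < y" "q * z * y < 1"
  shows "rate y < rate z"
proof -
  have "rate z - rate y = (y - z) * (1 - q * z * y) / (z * y)"
    using assms by (simp add: rate_def field_simps)
  also have "\<dots> > 0"
    using assms by (intro divide_pos_pos mult_pos_pos) auto
  finally show ?thesis by simp
qed

lemma power_rate:
  assumes "z > 0" "k > 0"
  shows "z ^ (k - 1) + q * z ^ Suc k = rate z * z ^ k"
  using assms by (cases k) (simp_all add: rate_def field_simps)

text \<open>\<open>z ^ length w\<close> is a supersolution of the recurrence: an eigenfunction away
  from the root, while at the root \<open>(q + 1) * z \<le> rate z\<close> because
  \<open>z \<le> 1 / z\<close>.\<close>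

lemma card_reductions_le:
  assumes "0 < z" "z \<le> 1" "reduced w" "set w \<subseteq> letters"
  shows "real (card (reductions n w)) \<le> z ^ length w * rate z ^ n"
  using assms(3,4)
proof (induction n arbitrary: w)
  case 0
  then show ?case using assms(1) by (simp add: card_reductions_0)
next
  case (Suc n)
  have "real (card (reductions (Suc n) w)) = (\<Sum>l\<in>letters. real (card (reductions n (push_letter l w))))"
    using card_reductions_Suc[OF Suc.prems(1)] by simp
  also have "\<dots> \<le> (\<Sum>l\<in>letters. z ^ length (push_letter l w) * rate z ^ n)"
    using Suc.prems by (intro sum_mono Suc.IH reduced_push set_push_letter_subset)
  also have "\<dots> = (\<Sum>l\<in>letters. z ^ length (push_letter l w)) * rate z ^ n"
    by (simp add: sum_distrib_right)
  also have "(\<Sum>l\<in>letters. z ^ length (push_letter l w)) \<le> rate z * z ^ length w"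
  proof (cases "w = []")
    case True
    have "z \<le> 1 / z" using assms(1,2) mult_mono[of z 1 z 1] by (simp add: field_simps)
    then show ?thesis
      using sum_length_push[of w "\<lambda>k. z ^ k"] True by (simp add: rate_def algebra_simps)
  next
    case False
    then show ?thesis
      using sum_length_push[of w "\<lambda>k. z ^ k"] power_rate[of z "length w"] assms(1) Suc.prems by simp
  qed
  finally show ?case
    using rate_pos[OF assms(1)] by (simp add: mult_right_mono algebra_simps)
qed

text \<open>
  For \<open>\<phi> k = z ^ k\<close> the recurrence of \<open>card_reductions_Suc\<close> is solved exactly away from the empty
  word, and \<open>(rate y / rate z) ^ N * y ^ k\<close> dominates the truncation error.
\<close>

lemma power_le_sum_card_reductions:
  assumes "0 < z" "z \<le> y" "reduced w" "set w \<subseteq> letters"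
  shows "z ^ length w \<le> (\<Sum>n\<le>N. card (reductions n w) / rate z ^ n) +
    (rate y / rate z) ^ N * y ^ length w"
  using assms(3,4)
proof (induction N arbitrary: w)
  case 0
  then show ?case using assms(1,2) by (simp add: card_reductions_0 power_mono)
next
  case (Suc N)
  have rz: "rate z > 0" and ry: "rate y > 0" using rate_pos assms by auto
  show ?case
  proof (cases "w = []")
    case True
    \<comment> \<open>The eigenvalue equation fails at the root, but there the term
      \<open>n = 0\<close> alone is already \<open>1\<close>.\<close>
    have "1 \<le> (\<Sum>n\<le>Suc N. card (reductions n w) / rate z ^ n)"
      using True rz by (subst sum.atMost_shift) (simp add: card_reductions_0 sum_nonneg)
    moreover have "(rate y / rate z) ^ Suc N * y ^ length w \<ge> 0"
      using rz ry assms(1,2) by simp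
    ultimately show ?thesis using True by (simp del: sum.atMost_Suc)
  next
    case False
    let ?\<eta> = "(rate y / rate z) ^ N"
    have "rate z * z ^ length w = (\<Sum>l\<in>letters. z ^ length (push_letter l w))"
      using sum_length_push[of w "\<lambda>k. z ^ k"] power_rate[of z "length w"] assms(1) Suc.prems False
      by simp
    also have "\<dots> \<le> (\<Sum>l\<in>letters. (\<Sum>n\<le>N. card (reductions n (push_letter l w)) / rate z ^ n) +
        ?\<eta> * y ^ length (push_letter l w))"
      using Suc.prems by (intro sum_mono Suc.IH reduced_push set_push_letter_subset)
    also have "\<dots> = (\<Sum>l\<in>letters. \<Sum>n\<le>N. card (reductions n (push_letter l w)) / rate z ^ n) +
        ?\<eta> * (\<Sum>l\<in>letters. y ^ length (push_letter l w))"
      by (simp add: sum.distrib sum_distrib_left)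
    also have "(\<Sum>l\<in>letters. \<Sum>n\<le>N. card (reductions n (push_letter l w)) / rate z ^ n) =
        (\<Sum>n\<le>N. card (reductions (Suc n) w) / rate z ^ n)"
      by (subst sum.swap) (simp add: card_reductions_Suc Suc.prems sum_divide_distrib)
    also have "\<dots> = rate z * (\<Sum>n\<le>Suc N. card (reductions n w) / rate z ^ n)"
      using False rz by (subst sum.atMost_Suc_shift)
        (simp add: card_reductions_0 sum_distrib_left)
    also have "(\<Sum>l\<in>letters. y ^ length (push_letter l w)) = rate y * y ^ length w"
      using sum_length_push[of w "\<lambda>k. y ^ k"] power_rate[of y "length w"] assms(1,2) Suc.prems False
      by simp
    also have "?\<eta> * (rate y * y ^ length w) = rate z * ((rate y / rate z) ^ Suc N * y ^ length w)"
      using rz by simp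
    finally show ?thesis
      using rz by (simp only: distrib_left[symmetric] mult_le_cancel_left_pos)
  qed
qed

section \<open>Words reducing to a walk\<close>

text \<open>Only the reduction has to be a walk in \<open>E\<close>: a word may leave
  \<open>E\<close> and come back, as in the Schreier graph obtained from \<open>E\<close> by
  attaching trees at the missing edges.\<close>

definition closing :: "('v \<times> 'a \<times> 'v) set \<Rightarrow> 'v \<Rightarrow> 'v \<Rightarrow> nat \<Rightarrow> 'a letter list set" where
  "closing E x y n = {w \<in> words n. walk E x (reduce_word w) y}"

definition cogrowth :: "('v \<times> 'a \<times> 'v) set \<Rightarrow> 'v \<Rightarrow> 'v \<Rightarrow> nat \<Rightarrow> real" where
  "cogrowth E x y n = real (card (closing E x y n))"

lemma finite_closing [simp]: "finite (closing E x y n)"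
  using finite_words by (simp add: closing_def)

lemma cogrowth_nonneg [simp]: "cogrowth E x y n \<ge> 0"
  by (simp add: cogrowth_def)

lemma closing_append:
  assumes "folded E" "u \<in> closing E x y m" "v \<in> closing E y z n"
  shows "u @ v \<in> closing E x z (m + n)"
proof -
  have "reduce_word (u @ v) = reduce_word (reduce_word u @ reduce_word v)"
    by (simp add: reduce_word_append_left reduce_word_append_right)
  moreover have "walk E x (reduce_word u @ reduce_word v) z"
    using assms by (auto simp: closing_def walk_append)
  ultimately have "walk E x (reduce_word (u @ v)) z"
    using walk_reduce_word[OF assms(1)] by simp
  then show ?thesis using assms by (auto simp: closing_def words_def)
qed

lemma cogrowth_mult_le:
  assumes "folded E"
  shows "cogrowth E x y m * cogrowth E y z n \<le> cogrowth E x z (m + n)"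
proof -
  have "inj_on (\<lambda>(u, v). u @ v) (closing E x y m \<times> closing E y z n)"
    by (auto simp: inj_on_def closing_def words_def)
  moreover have "(\<lambda>(u, v). u @ v) ` (closing E x y m \<times> closing E y z n) \<subseteq> closing E x z (m + n)"
    using closing_append[OF assms] by auto
  ultimately have "card (closing E x y m \<times> closing E y z n) \<le> card (closing E x z (m + n))"
    by (rule card_inj_on_le) simp
  then show ?thesis
    unfolding cogrowth_def card_cartesian_product by (metis of_nat_le_iff of_nat_mult)
qed

lemma cogrowth_power_le:
  assumes "folded E"
  shows "cogrowth E x x n ^ k \<le> cogrowth E x x (n * k)"
proof (induction k)
  case 0
  have "[] \<in> closing E x x 0" by (simp add: closing_def words_def)
  then have "card (closing E x x 0) > 0" by (auto simp: card_gt_0_iff)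
  then show ?case by (simp add: cogrowth_def)
next
  case (Suc k)
  have "cogrowth E x x n ^ Suc k \<le> cogrowth E x x n * cogrowth E x x (n * k)"
    using Suc by (simp add: mult_left_mono)
  also have "\<dots> \<le> cogrowth E x x (n * Suc k)"
    using cogrowth_mult_le[OF assms] by simp
  finally show ?case .
qed

lemma closing_inv_word: "w \<in> closing E x y n \<Longrightarrow> inv_word w \<in> closing E y x n"
  by (simp add: closing_def words_def reduce_word_inv_word walk_inv_word set_inv_word)

lemma cogrowth_commute: "cogrowth E x y n = cogrowth E y x n"
proof -
  have "bij_betw inv_word (closing E x y n) (closing E y x n)"
    by (rule bij_betwI[where g = inv_word]) (auto intro: closing_inv_word)
  then show ?thesis unfolding cogrowth_def by (metis bij_betw_same_card)
qed

end

lemma le_one_if_powers_bounded: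
  fixes a :: real
  assumes "\<And>k. a ^ k \<le> M"
  shows "a \<le> 1"
proof (rule ccontr)
  assume "\<not> a \<le> 1"
  then obtain k where "M < a ^ k" using real_arch_pow[of a M] by auto
  then show False using assms[of k] by simp
qed

context free_alphabet begin

text \<open>The bound at length \<open>n * k\<close> bounds the \<open>k\<close>-th power of the
  normalised count at length \<open>n\<close>, so \<open>M\<close> disappears as \<open>k\<close>
  grows.\<close>

lemma cogrowth_le_of_bounded:
  assumes "folded E" "R > 0" "\<And>n. cogrowth E x x n \<le> M * R ^ n"
  shows "cogrowth E x x n \<le> R ^ n"
proof -
  have "(cogrowth E x x n / R ^ n) ^ k \<le> M" for k
  proof -
    have "cogrowth E x x n ^ k \<le> M * R ^ (n * k)"
      using cogrowth_power_le[OF assms(1)] assms(3) order_trans by blast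
    then show ?thesis
      using assms(2) by (simp add: power_divide field_simps flip: power_mult)
  qed
  then have "cogrowth E x x n / R ^ n \<le> 1" by (rule le_one_if_powers_bounded)
  then show ?thesis using assms(2) by (simp add: field_simps)
qed

text \<open>Conjugating by a path from \<open>o'\<close> to \<open>x\<close> changes lengths by a
  constant, which \<open>cogrowth_le_of_bounded\<close> removes; for two vertices, going there and
  back gives a closed walk of length \<open>n + n\<close>.\<close>

lemma cogrowth_le_everywhere:
  assumes E: "folded E" and R: "R > 0" and base: "\<And>n. cogrowth E o' o' n \<le> R ^ n"
    and reach: "\<And>x. \<exists>w. set w \<subseteq> letters \<and> walk E o' w x"
  shows "cogrowth E x y n \<le> R ^ n"
proof -
  have closed: "cogrowth E x x n \<le> R ^ n" for x n
  proof (rule cogrowth_le_of_bounded[OF E R, where M = "R ^ (2 * length (SOME w. set w \<subseteq> letters \<and> walk E o' w x))"])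
    fix n
    define w where "w = (SOME w. set w \<subseteq> letters \<and> walk E o' w x)"
    have w: "set w \<subseteq> letters \<and> walk E o' w x"
      unfolding w_def by (rule someI_ex[OF reach])
    then have "w \<in> closing E o' x (length w)"
      by (auto simp: closing_def words_def walk_reduce_word E)
    then have "card (closing E o' x (length w)) > 0" by (auto simp: card_gt_0_iff)
    then have pos: "cogrowth E o' x (length w) \<ge> 1" by (simp add: cogrowth_def)
    have "cogrowth E x x n \<le> cogrowth E o' x (length w) * cogrowth E x x n"
      using mult_right_mono[OF pos, of "cogrowth E x x n"] by simp
    also have "\<dots> \<le> cogrowth E o' x (length w + n)"
      by (rule cogrowth_mult_le[OF E])
    also have "\<dots> \<le> cogrowth E o' x (length w + n) * cogrowth E x o' (length w)"
      using mult_left_mono[OF pos, of "cogrowth E o' x (length w + n)"]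
      by (simp add: cogrowth_commute[of E x o'])
    also have "\<dots> \<le> cogrowth E o' o' (length w + n + length w)"
      by (rule cogrowth_mult_le[OF E])
    also have "\<dots> \<le> R ^ (length w + n + length w)" by (rule base)
    finally show "cogrowth E x x n \<le> R ^ (2 * length w) * R ^ n"
      by (simp add: power_add mult_2 mult_2_right mult_ac)
  qed
  have "(cogrowth E x y n)\<^sup>2 = cogrowth E x y n * cogrowth E y x n"
    by (simp add: power2_eq_square cogrowth_commute[of E y x])
  also have "\<dots> \<le> cogrowth E x x (n + n)"
    by (rule cogrowth_mult_le[OF E])
  also have "\<dots> \<le> (R ^ n)\<^sup>2"
    using closed[of x "n + n"] by (simp add: power2_eq_square power_add)
  finally show ?thesis
    by (rule power2_le_imp_le) (use R in simp)
qed

section \<open>The two halves of the cogrowth formula\<close>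

lemma sum_card_reductions_le_cogrowth:
  assumes "finite T" "T \<subseteq> stab S E x y"
  shows "(\<Sum>w\<in>T. real (card (reductions n w))) \<le> cogrowth E x y n"
proof -
  have "(\<Sum>w\<in>T. card (reductions n w)) = card (\<Union>w\<in>T. reductions n w)"
    using assms(1) by (intro card_UN_disjoint[symmetric] ballI impI finite_reductions)
      (auto simp: reductions_def)
  also have "\<dots> \<le> card (closing E x y n)"
    using assms(2) by (intro card_mono finite_closing) (auto simp: reductions_def closing_def stab_def)
  finally show ?thesis
    unfolding cogrowth_def by (metis of_nat_le_iff of_nat_sum)
qed

text \<open>The lower bound \<open>power_le_sum_card_reductions\<close> is summed over
  \<open>T\<close>: the main terms form a geometric series in \<open>R / rate z\<close>, and the
  truncation error vanishes as \<open>N\<close> grows because \<open>T\<close> is finite.\<close>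

lemma sum_power_le_of_cogrowth:
  assumes z: "0 < z" "q * z\<^sup>2 < 1" "R < rate z" and R: "R \<ge> 0"
    and bound: "\<And>n. cogrowth E x y n \<le> R ^ n"
    and T: "finite T" "T \<subseteq> stab S E x y"
  shows "(\<Sum>w\<in>T. z ^ length w) \<le> 1 / (1 - R / rate z)"
proof -
  \<comment> \<open>Any \<open>y'\<close> strictly between \<open>z\<close> and
    \<open>1 / (q * z)\<close> gives \<open>rate y' < rate z\<close>, hence a decaying error term;
    the midpoint is taken.\<close>
  obtain y' where y': "z < y'" "q * z * y' < 1"
  proof
    have "q * z > 0" using q_ge_1 z by simp
    then have *: "z < 1 / (q * z)"
      using z(2) by (simp add: field_simps power2_eq_square)
    define y' where "y' = (z + 1 / (q * z)) / 2"
    show "z < y'" using * by (simp add: y'_def)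
    have "y' < 1 / (q * z)" using * by (simp add: y'_def)
    then show "q * z * y' < 1" using \<open>q * z > 0\<close> by (simp add: field_simps)
  qed
  let ?\<eta> = "rate y' / rate z"
  have rz: "rate z > 0" and ry: "rate y' > 0" using rate_pos z y' by auto
  have \<eta>: "0 \<le> ?\<eta>" "?\<eta> < 1"
    using rate_strict_antimono[OF z(1) y'] rz ry by auto
  have "(\<Sum>w\<in>T. z ^ length w) \<le> 1 / (1 - R / rate z) + ?\<eta> ^ N * (\<Sum>w\<in>T. y' ^ length w)" for N
  proof -
    have "(\<Sum>w\<in>T. z ^ length w) \<le>
        (\<Sum>w\<in>T. (\<Sum>n\<le>N. card (reductions n w) / rate z ^ n) + ?\<eta> ^ N * y' ^ length w)"
      using T z y' by (intro sum_mono power_le_sum_card_reductions) (auto simp: stab_def)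
    also have "\<dots> = (\<Sum>n\<le>N. (\<Sum>w\<in>T. card (reductions n w)) / rate z ^ n) +
        ?\<eta> ^ N * (\<Sum>w\<in>T. y' ^ length w)"
      by (subst sum.distrib, subst sum.swap) (simp add: sum_distrib_left sum_divide_distrib)
    also have "(\<Sum>n\<le>N. (\<Sum>w\<in>T. card (reductions n w)) / rate z ^ n) \<le> (\<Sum>n\<le>N. (R / rate z) ^ n)"
    proof (rule sum_mono)
      fix n
      have "real (\<Sum>w\<in>T. card (reductions n w)) \<le> R ^ n"
        using sum_card_reductions_le_cogrowth[OF T, of n] bound[of n] by simp
      then show "(\<Sum>w\<in>T. card (reductions n w)) / rate z ^ n \<le> (R / rate z) ^ n"
        using rz by (simp add: power_divide divide_right_mono)
    qed
    also have "(\<Sum>n\<le>N. (R / rate z) ^ n) \<le> (\<Sum>n. (R / rate z) ^ n)"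
      using R rz z by (intro sum_le_suminf summable_geometric) auto
    also have "\<dots> = 1 / (1 - R / rate z)"
      using R rz z by (intro suminf_geometric) auto
    finally show ?thesis by simp
  qed
  moreover have "(\<lambda>N. 1 / (1 - R / rate z) + ?\<eta> ^ N * (\<Sum>w\<in>T. y' ^ length w))
      \<longlonglongrightarrow> 1 / (1 - R / rate z) + 0 * (\<Sum>w\<in>T. y' ^ length w)"
    using \<eta> by (intro tendsto_intros LIMSEQ_realpow_zero)
  ultimately show ?thesis
    using LIMSEQ_le_const[of "\<lambda>N. 1 / (1 - R / rate z) + ?\<eta> ^ N * (\<Sum>w\<in>T. y' ^ length w)"
        "1 / (1 - R / rate z)" "\<Sum>w\<in>T. z ^ length w"] by simp
qed

text \<open>Converse half: unreduced words are grouped by their reduction, each group is estimated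
  by \<open>card_reductions_le\<close>, and the factor \<open>M\<close> drops out.\<close>

lemma cogrowth_le_of_sum_power:
  assumes E: "folded E" and z: "0 < z" "z \<le> 1"
    and bound: "\<And>T. finite T \<Longrightarrow> T \<subseteq> stab S E x x \<Longrightarrow> (\<Sum>w\<in>T. z ^ length w) \<le> M"
  shows "cogrowth E x x n \<le> rate z ^ n"
proof (rule cogrowth_le_of_bounded[OF E rate_pos[OF z(1)]])
  fix n
  let ?T = "reduce_word ` closing E x x n"
  have T: "?T \<subseteq> stab S E x x"
    by (auto simp: closing_def stab_def words_def reduced_reduce_word dest: set_reduce_word_subset)
  have "card (closing E x x n) \<le> card (\<Union>w\<in>?T. reductions n w)"
    by (intro card_mono finite_UN_I finite_imageI finite_closing finite_reductions)
      (auto simp: reductions_def closing_def)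
  also have "\<dots> \<le> (\<Sum>w\<in>?T. card (reductions n w))"
    by (rule card_UN_le) simp
  finally have "cogrowth E x x n \<le> (\<Sum>w\<in>?T. real (card (reductions n w)))"
    unfolding cogrowth_def by (metis of_nat_le_iff of_nat_sum)
  also have "\<dots> \<le> (\<Sum>w\<in>?T. z ^ length w * rate z ^ n)"
    using T z by (intro sum_mono card_reductions_le) (auto simp: stab_def)
  also have "\<dots> = (\<Sum>w\<in>?T. z ^ length w) * rate z ^ n"
    by (simp add: sum_distrib_right)
  also have "\<dots> \<le> M * rate z ^ n"
    using bound[OF _ T] rate_pos[OF z(1)] by (intro mult_right_mono) auto
  finally show "cogrowth E x x n \<le> M * rate z ^ n" .
qed

end

section \<open>Adding one edge\<close>

text \<open>The second case cuts at the first use of the new edge, so \<open>w1\<close> stays in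
  \<open>E\<close>; \<open>c\<close> records the direction of crossing.\<close>

lemma walk_insertE:
  assumes "walk (insert (x, s, y) E) u w v"
  obtains "walk E u w v"
  | w1 c w2 where "w = w1 @ (s, c) # w2" "walk E u w1 (if c then x else y)"
      "walk (insert (x, s, y) E) (if c then y else x) w2 v"
proof -
  have "walk E u w v \<or> (\<exists>w1 c w2. w = w1 @ (s, c) # w2 \<and> walk E u w1 (if c then x else y) \<and>
      walk (insert (x, s, y) E) (if c then y else x) w2 v)"
    using assms
  proof (induction w arbitrary: u)
    case (Cons l w)
    then obtain p where p: "edge (insert (x, s, y) E) u l p" "walk (insert (x, s, y) E) p w v" by auto
    show ?case
    proof (cases "edge E u l p")
      case True
      from Cons.IH[OF p(2)] show ?thesis
      proof (elim disjE exE conjE)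
        fix w1 c w2 assume "w = w1 @ (s, c) # w2" "walk E p w1 (if c then x else y)"
          "walk (insert (x, s, y) E) (if c then y else x) w2 v"
        with True show ?thesis
          by (intro disjI2 exI[of _ "l # w1"] exI[of _ c] exI[of _ w2]) auto
      qed (use True in auto)
    next
      case False
      obtain s' c where l: "l = (s', c)" by (cases l)
      have "s' = s" "u = (if c then x else y)" "p = (if c then y else x)"
        using False p(1) l by (auto simp: edge_def split: if_splits)
      then show ?thesis
        using p(2) l by (intro disjI2 exI[of _ "[]"] exI[of _ c] exI[of _ w]) auto
    qed
  qed simp
  then show thesis using that by blast
qed

text \<open>Generating functions turn concatenation into products. Only an upper bound is wanted, so
  it does no harm if a word splits in several ways.\<close>

lemma sum_power_length_split:
  fixes z :: real and B D :: "bool \<Rightarrow> 'a letter list set"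
  assumes z: "z > 0" and fin: "finite T" "\<And>c. finite (B c)" "\<And>c. finite (D c)"
    and split: "\<And>w. w \<in> T \<Longrightarrow> w \<notin> A \<Longrightarrow> \<exists>c w1 w2. w = w1 @ (s, c) # w2 \<and> w1 \<in> B c \<and> w2 \<in> D c"
  shows "(\<Sum>w\<in>T. z ^ length w) \<le> (\<Sum>w\<in>T \<inter> A. z ^ length w) +
    (\<Sum>c\<in>UNIV. z * (\<Sum>w\<in>B c. z ^ length w) * (\<Sum>w\<in>D c. z ^ length w))"
proof -
  define P where "P c = (\<lambda>(w1, w2). w1 @ (s, c) # w2) ` (B c \<times> D c)" for c
  have finP: "finite (P c)" for c using fin by (simp add: P_def)
  have nonneg: "0 \<le> z ^ length w" for w :: "'a letter list" using z by simp
  have "(\<Sum>w\<in>T. z ^ length w) \<le> (\<Sum>w\<in>(T \<inter> A) \<union> (\<Union>c\<in>UNIV. P c). z ^ length w)"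
  proof (rule sum_mono2)
    show "T \<subseteq> T \<inter> A \<union> (\<Union>c\<in>UNIV. P c)"
    proof
      fix w assume "w \<in> T"
      show "w \<in> T \<inter> A \<union> (\<Union>c\<in>UNIV. P c)"
      proof (cases "w \<in> A")
        case False
        with split[OF \<open>w \<in> T\<close>] obtain c w1 w2 where "w = w1 @ (s, c) # w2" "w1 \<in> B c" "w2 \<in> D c"
          by blast
        then have "w \<in> P c" by (force simp: P_def)
        then show ?thesis by blast
      qed (use \<open>w \<in> T\<close> in simp)
    qed
  qed (use fin finP nonneg in auto)
  also have "\<dots> \<le> (\<Sum>w\<in>T \<inter> A. z ^ length w) + (\<Sum>w\<in>(\<Union>c\<in>UNIV. P c). z ^ length w)"
    using fin(1) finP nonneg by (subst sum_Un) (auto intro!: sum_nonneg)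
  also have "(\<Sum>w\<in>(\<Union>c\<in>UNIV. P c). z ^ length w) \<le> (\<Sum>c\<in>UNIV. \<Sum>w\<in>P c. z ^ length w)"
    using finP nonneg by (simp add: UNIV_bool sum_Un sum_nonneg)
  also have "\<dots> \<le> (\<Sum>c\<in>UNIV. z * (\<Sum>w\<in>B c. z ^ length w) * (\<Sum>w\<in>D c. z ^ length w))"
  proof (rule sum_mono)
    fix c
    have "(\<Sum>w\<in>P c. z ^ length w) \<le>
        (\<Sum>p\<in>B c \<times> D c. z ^ length (case p of (w1, w2) \<Rightarrow> w1 @ (s, c) # w2))"
      unfolding P_def using fin z by (intro order_trans[OF sum_image_le]) (auto simp: comp_def)
    also have "\<dots> = (\<Sum>(w1, w2)\<in>B c \<times> D c. z * z ^ length w1 * z ^ length w2)"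
      by (rule sum.cong) (auto simp: power_add)
    also have "\<dots> = z * (\<Sum>w\<in>B c. z ^ length w) * (\<Sum>w\<in>D c. z ^ length w)"
      by (simp add: sum.cartesian_product[symmetric] sum_distrib_left sum_distrib_right mult_ac)
    finally show "(\<Sum>w\<in>P c. z ^ length w) \<le> z * (\<Sum>w\<in>B c. z ^ length w) * (\<Sum>w\<in>D c. z ^ length w)" .
  qed
  finally show ?thesis by simp
qed

context free_alphabet begin

lemma finite_length_le: "finite {w. set w \<subseteq> letters \<and> length w \<le> n}"
  using finite_lists_length_le[OF finite_letters] by simp

text \<open>A closed walk is cut at its uses of the new edge. The pieces between consecutive uses
  join endpoints of the edge inside \<open>E\<close> and weigh at most \<open>\<epsilon>\<close>, so
  they form a geometric series; the first and the last piece are bounded by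
  \<open>C\<close>.\<close>

lemma sum_power_insert_edge:
  fixes z C \<epsilon> :: real
  assumes z: "0 < z" and xy: "x \<noteq> y" and \<epsilon>: "4 * z * \<epsilon> \<le> 1"
    and all: "\<And>u v T. finite T \<Longrightarrow> T \<subseteq> stab S E u v \<Longrightarrow> (\<Sum>w\<in>T. z ^ length w) \<le> C"
    and far: "\<And>u v T. u \<in> {x, y} \<Longrightarrow> v \<in> {x, y} \<Longrightarrow> finite T \<Longrightarrow> T \<subseteq> stab S E u v \<Longrightarrow> [] \<notin> T \<Longrightarrow>
      (\<Sum>w\<in>T. z ^ length w) \<le> \<epsilon>"
    and T: "finite T" "T \<subseteq> stab S (insert (x, s, y) E) o' o'"
  shows "(\<Sum>w\<in>T. z ^ length w) \<le> C + 4 * z * C * C"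
proof -
  let ?F = "insert (x, s, y) E"
  define src where "src c = (if c then x else y)" for c
  define dst where "dst c = (if c then y else x)" for c
  \<comment> \<open>What may follow a crossing in direction \<open>c\<close>: the condition on the
    head excludes an immediate return across the edge, and the cut-off \<open>n\<close> makes the
    set finite and allows induction.\<close>
  define Y where "Y n c = {w \<in> stab S ?F (dst c) o'. length w \<le> n \<and> (w = [] \<or> hd w \<noteq> inv_letter (s, c))}"
    for n c
  have finY: "finite (Y n c)" for n c
    by (rule finite_subset[OF _ finite_length_le[of n]]) (auto simp: Y_def stab_def)
  have C: "C \<ge> 0" using all[of "{}"] by simp
  have \<epsilon>0: "\<epsilon> \<ge> 0" using far[of x x "{}"] by simp
  have nonneg: "0 \<le> z ^ length w" for w :: "'a letter list" using z by simp
  have Y_split: "\<exists>c' w1 w2. w = w1 @ (s, c') # w2 \<and> w1 \<in> stab S E u (src c') \<and> w2 \<in> Y (length w - 1) c'"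
    if w: "w \<in> stab S ?F u o'" "w \<notin> stab S E u o'" for w u
  proof -
    have "walk ?F u w o'" using w(1) by (simp add: stab_def)
    then show ?thesis
    proof (cases rule: walk_insertE)
      case 1
      then show ?thesis using w by (simp add: stab_def)
    next
      case (2 w1 c w2)
      then have "w1 \<in> stab S E u (src c)" "w2 \<in> Y (length w - 1) c"
        using w(1) reduced_appendD[of w1 "(s, c) # w2"]
        by (auto simp: stab_def Y_def src_def dst_def reduced_Cons)
      then show ?thesis using 2(1) by blast
    qed
  qed
  have Y_le: "(\<Sum>w\<in>Y n c. z ^ length w) \<le> 2 * C" for n c
  proof (induction n arbitrary: c)
    case 0
    have "Y 0 c \<subseteq> stab S E (dst c) o'"
      by (auto simp: Y_def stab_def)
    then have "(\<Sum>w\<in>Y 0 c. z ^ length w) \<le> C" using all finY by blast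
    then show ?case using C by simp
  next
    case (Suc n)
    define B where "B c' = {w \<in> stab S E (dst c) (src c'). w \<noteq> [] \<and> length w \<le> n}" for c'
    have finB: "finite (B c')" for c'
      by (rule finite_subset[OF _ finite_length_le[of n]]) (auto simp: B_def stab_def)
    have "(\<Sum>w\<in>Y (Suc n) c. z ^ length w) \<le> (\<Sum>w\<in>Y (Suc n) c \<inter> stab S E (dst c) o'. z ^ length w) +
        (\<Sum>c'\<in>UNIV. z * (\<Sum>w\<in>B c'. z ^ length w) * (\<Sum>w\<in>Y n c'. z ^ length w))"
    proof (rule sum_power_length_split[OF z finY finB finY])
      fix w assume w: "w \<in> Y (Suc n) c" "w \<notin> stab S E (dst c) o'"
      then obtain c' w1 w2 where d: "w = w1 @ (s, c') # w2" "w1 \<in> stab S E (dst c) (src c')"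
          "w2 \<in> Y (length w - 1) c'"
        using Y_split[of w "dst c"] by (auto simp: Y_def)
      \<comment> \<open>An empty piece between two crossings would mean crossing the edge straight
        back, since \<open>x \<noteq> y\<close>; hence the bound \<open>\<epsilon>\<close> applies
        to \<open>w1\<close>.\<close>
      have "w1 \<noteq> []"
      proof
        assume "w1 = []"
        then have "dst c = src c'" using d(2) by (simp add: stab_def)
        then have "c' = (\<not> c)" using xy by (auto simp: src_def dst_def split: if_splits)
        then show False
          using w(1) d(1) \<open>w1 = []\<close> by (simp add: Y_def inv_letter_def)
      qed
      then have "w1 \<in> B c'" "w2 \<in> Y n c'"
        using w(1) d by (auto simp: B_def Y_def)
      then show "\<exists>c' w1 w2. w = w1 @ (s, c') # w2 \<and> w1 \<in> B c' \<and> w2 \<in> Y n c'"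
        using d(1) by blast
    qed
    also have "\<dots> \<le> C + (\<Sum>c'\<in>(UNIV :: bool set). z * \<epsilon> * (2 * C))"
    proof (intro add_mono sum_mono mult_mono)
      show "(\<Sum>w\<in>Y (Suc n) c \<inter> stab S E (dst c) o'. z ^ length w) \<le> C"
        using finY by (intro all[of _ "dst c" o']) auto
      show "(\<Sum>w\<in>B c'. z ^ length w) \<le> \<epsilon>" for c'
        using finB by (intro far[of "dst c" "src c'"]) (auto simp: B_def src_def dst_def)
    qed (use z \<epsilon>0 C Suc.IH in \<open>auto intro!: sum_nonneg\<close>)
    \<comment> \<open>Two directions contribute \<open>z * \<epsilon> * (2 * C)\<close> each;
      \<open>4 * z * \<epsilon> \<le> 1\<close> is what reproduces the bound
      \<open>2 * C\<close>.\<close>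
    also have "\<dots> = C + (4 * z * \<epsilon>) * C" by (simp add: UNIV_bool)
    also have "\<dots> \<le> 2 * C"
      using mult_right_mono[OF \<epsilon> C] by simp
    finally show ?case .
  qed
  define n where "n = Max (length ` T)"
  have n: "length w \<le> n" if "w \<in> T" for w
    using T(1) that by (simp add: n_def)
  define B where "B c = {w \<in> stab S E o' (src c). length w \<le> n}" for c
  have finB: "finite (B c)" for c
    by (rule finite_subset[OF _ finite_length_le[of n]]) (auto simp: B_def stab_def)
  have "(\<Sum>w\<in>T. z ^ length w) \<le> (\<Sum>w\<in>T \<inter> stab S E o' o'. z ^ length w) +
      (\<Sum>c\<in>UNIV. z * (\<Sum>w\<in>B c. z ^ length w) * (\<Sum>w\<in>Y n c. z ^ length w))"
  proof (rule sum_power_length_split[OF z T(1) finB finY])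
    fix w assume w: "w \<in> T" "w \<notin> stab S E o' o'"
    then obtain c w1 w2 where d: "w = w1 @ (s, c) # w2" "w1 \<in> stab S E o' (src c)"
        "w2 \<in> Y (length w - 1) c"
      using Y_split[of w o'] T(2) by blast
    then have "w1 \<in> B c" "w2 \<in> Y n c"
      using n[OF w(1)] by (auto simp: B_def Y_def)
    then show "\<exists>c w1 w2. w = w1 @ (s, c) # w2 \<and> w1 \<in> B c \<and> w2 \<in> Y n c"
      using d(1) by blast
  qed
  also have "\<dots> \<le> C + (\<Sum>c\<in>(UNIV :: bool set). z * C * (2 * C))"
  proof (intro add_mono sum_mono mult_mono)
    show "(\<Sum>w\<in>T \<inter> stab S E o' o'. z ^ length w) \<le> C"
      using T(1) by (intro all[of _ o' o']) auto
    show "(\<Sum>w\<in>B c. z ^ length w) \<le> C" for c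
      using finB by (intro all[of _ o' "src c"]) (auto simp: B_def)
  qed (use z C Y_le in \<open>auto intro!: sum_nonneg\<close>)
  also have "\<dots> = C + 4 * z * C * C" by (simp add: UNIV_bool)
  finally show ?thesis .
qed

end

section \<open>Edges inside a finite set of vertices\<close>

text \<open>The \<open>n\<close>-th power of the matrix \<open>m\<close>, restricted to
  \<open>I\<close>, applied to the constant function \<open>1\<close>.\<close>

fun iterate :: "('v \<Rightarrow> 'v \<Rightarrow> real) \<Rightarrow> 'v set \<Rightarrow> nat \<Rightarrow> 'v \<Rightarrow> real" where
  "iterate m I 0 x = 1"
| "iterate m I (Suc n) x = (\<Sum>y\<in>I. m x y * iterate m I n y)"

text \<open>Symmetry makes \<open>m\<close> self-adjoint, so \<open>i\<close> of the factors can be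
  moved to the other argument of the inner product with \<open>1\<close>.\<close>

lemma sum_iterate_mult:
  assumes sym: "\<And>x y. m x y = m y x"
  shows "(\<Sum>x\<in>I. iterate m I (i + j) x) = (\<Sum>x\<in>I. iterate m I i x * iterate m I j x)"
proof (induction i arbitrary: j)
  case (Suc i)
  have "(\<Sum>x\<in>I. iterate m I (Suc i + j) x) = (\<Sum>x\<in>I. iterate m I i x * iterate m I (Suc j) x)"
    using Suc[of "Suc j"] by simp
  also have "\<dots> = (\<Sum>x\<in>I. \<Sum>y\<in>I. m x y * iterate m I i x * iterate m I j y)"
    by (simp add: sum_distrib_left mult_ac)
  also have "\<dots> = (\<Sum>y\<in>I. \<Sum>x\<in>I. m y x * iterate m I i x * iterate m I j y)"
    by (subst sum.swap) (simp add: sym)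
  also have "\<dots> = (\<Sum>y\<in>I. iterate m I (Suc i) y * iterate m I j y)"
    by (simp add: sum_distrib_right)
  finally show ?case .
qed simp

text \<open>
  The Rayleigh quotient of the constant function is at most the spectral radius of \<open>m\<close>.
\<close>

lemma sum_matrix_le:
  fixes m :: "'v \<Rightarrow> 'v \<Rightarrow> real" and R M :: real
  assumes fin: "finite I" and sym: "\<And>x y. m x y = m y x" and nonneg: "\<And>x y. m x y \<ge> 0" and R: "R > 0"
    and bound: "\<And>n. (\<Sum>x\<in>I. iterate m I n x) \<le> M * R ^ n"
  shows "(\<Sum>x\<in>I. \<Sum>y\<in>I. m x y) \<le> card I * R"
proof (cases "I = {}")
  case False
  define N where "N = real (card I)"
  have N: "N > 0" using False fin by (simp add: N_def card_gt_0_iff)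
  define W where "W n = (\<Sum>x\<in>I. iterate m I n x)" for n
  have it_nonneg: "iterate m I n x \<ge> 0" for n x
    by (induction n arbitrary: x) (auto intro!: sum_nonneg simp: nonneg)
  have W_nonneg: "W n \<ge> 0" for n by (simp add: W_def sum_nonneg it_nonneg)
  have double: "(W n)\<^sup>2 \<le> N * W (n + n)" for n
  proof -
    \<comment> \<open>Cauchy-Schwarz against the constant function, in the form that a variance is
      nonnegative.\<close>
    have "0 \<le> (\<Sum>x\<in>I. (iterate m I n x - W n / N)\<^sup>2)" by (simp add: sum_nonneg)
    also have "\<dots> = (\<Sum>x\<in>I. iterate m I n x * iterate m I n x - 2 * (W n / N) * iterate m I n x +
        (W n / N)\<^sup>2)"
      by (simp add: power2_eq_square algebra_simps)
    also have "\<dots> = (\<Sum>x\<in>I. iterate m I n x * iterate m I n x) - 2 * (W n / N) * W n + N * (W n / N)\<^sup>2"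
      by (simp only: sum.distrib sum_subtractf sum_distrib_left[symmetric] W_def[symmetric]
          sum_constant N_def)
    also have "\<dots> = W (n + n) - (W n)\<^sup>2 / N"
      using N sum_iterate_mult[where m = m and I = I and i = n and j = n, OF sym]
      by (simp add: W_def[of "n + n"] power2_eq_square)
    finally show ?thesis using N by (simp add: field_simps)
  qed
  \<comment> \<open>Squaring doubles the exponent, so only powers of two are compared; these suffice
    to bound a growth rate.\<close>
  have iter: "(W 1 / N) ^ (2 ^ k) \<le> W (2 ^ k) / N" for k
  proof (induction k)
    case (Suc k)
    have "(W 1 / N) ^ (2 ^ Suc k) = ((W 1 / N) ^ (2 ^ k))\<^sup>2"
      by (simp flip: power_mult add: mult.commute)
    also have "\<dots> \<le> (W (2 ^ k) / N)\<^sup>2"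
      using Suc N W_nonneg by (intro power_mono) auto
    also have "\<dots> \<le> W (2 ^ Suc k) / N"
      using double[of "2 ^ k"] N by (simp add: power2_eq_square field_simps mult_2)
    finally show ?case .
  qed simp
  have "W 1 / N / R \<le> 1"
  proof (rule ccontr)
    let ?a = "W 1 / N / R"
    assume a: "\<not> ?a \<le> 1"
    have "?a ^ k \<le> M / N" for k
    proof -
      have "?a ^ k \<le> ?a ^ (2 ^ k)"
        using a by (intro power_increasing) (auto simp: less_imp_le)
      also have "\<dots> \<le> W (2 ^ k) / N / R ^ (2 ^ k)"
        using divide_right_mono[OF iter[of k], of "R ^ (2 ^ k)"] R
        by (simp only: power_divide) simp
      also have "\<dots> \<le> M / N"
        using bound[of "2 ^ k"] R N by (simp add: W_def field_simps)
      finally show ?thesis .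
    qed
    then show False using le_one_if_powers_bounded a by blast
  qed
  then have "W 1 \<le> N * R" using N R by (simp add: field_simps)
  then show ?thesis by (simp add: W_def N_def)
qed simp

context free_alphabet begin

text \<open>Each term prepends a letter \<open>l\<close> to the words from \<open>v\<close> to
  \<open>y\<close>; as \<open>E\<close> is folded, \<open>l\<close> determines \<open>v\<close>, so
  no word is produced twice.\<close>

lemma sum_edges_cogrowth_le:
  assumes "folded E" "finite I"
  shows "(\<Sum>v\<in>I. (\<Sum>l\<in>letters. of_bool (edge E x l v)) * cogrowth E v y n) \<le> cogrowth E x y (Suc n)"
proof -
  define K where "K = {p \<in> I \<times> letters. edge E x (snd p) (fst p)}"
  have K: "finite K" using assms finite_letters by (simp add: K_def)
  have "(\<Sum>v\<in>I. (\<Sum>l\<in>letters. of_bool (edge E x l v)) * cogrowth E v y n) =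
      (\<Sum>p\<in>I \<times> letters. of_bool (edge E x (snd p) (fst p)) * cogrowth E (fst p) y n)"
    by (simp add: sum_distrib_right sum.cartesian_product case_prod_beta)
  also have "\<dots> = (\<Sum>p\<in>I \<times> letters. if edge E x (snd p) (fst p) then cogrowth E (fst p) y n else 0)"
    by (intro sum.cong) auto
  also have "\<dots> = (\<Sum>p\<in>K. cogrowth E (fst p) y n)"
    using assms finite_letters unfolding K_def by (intro sum.inter_filter[symmetric]) simp
  also have "\<dots> = real (card (SIGMA p:K. closing E (fst p) y n))"
    using K by (simp add: cogrowth_def)
  also have "\<dots> \<le> real (card (closing E x y (Suc n)))"
  proof -
    have "inj_on (\<lambda>(p, w). snd p # w) (SIGMA p:K. closing E (fst p) y n)"
      using foldedD[OF assms(1)] by (auto simp: inj_on_def K_def)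
    moreover have "(\<lambda>(p, w). snd p # w) ` (SIGMA p:K. closing E (fst p) y n) \<subseteq> closing E x y (Suc n)"
      using assms(1) by (auto simp: K_def closing_def words_def reduce_word_Cons intro: walk_push)
    ultimately show ?thesis using card_inj_on_le finite_closing by (metis of_nat_le_iff)
  qed
  finally show ?thesis by (simp add: cogrowth_def)
qed

text \<open>Powers of the adjacency matrix of \<open>E\<close> on \<open>I\<close> count walks
  inside \<open>I\<close>, which \<open>cogrowth\<close> dominates, so \<open>R\<close> bounds its
  spectral radius and therefore its average row sum.\<close>

lemma card_inner_edges_le:
  fixes R :: real
  assumes E: "folded E" and I: "finite I" and R: "R > 0"
    and bound: "\<And>x y n. cogrowth E x y n \<le> R ^ n"
  shows "(\<Sum>l\<in>letters. real (card {x \<in> I. \<exists>y\<in>I. edge E x l y})) \<le> card I * R"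
proof -
  define m :: "_ \<Rightarrow> _ \<Rightarrow> real" where "m x y = (\<Sum>l\<in>letters. of_bool (edge E x l y))" for x y
  have sym: "m x y = m y x" for x y
  proof -
    have "m x y = (\<Sum>l\<in>letters. of_bool (edge E x (inv_letter l) y))"
      unfolding m_def by (rule sum.reindex_bij_betw[OF bij_inv_letter, symmetric])
    then show ?thesis by (simp add: m_def edge_inv_letter)
  qed
  have m_nonneg: "m x y \<ge> 0" for x y
    by (simp add: m_def sum_nonneg)
  have "iterate m I n x \<le> (\<Sum>y\<in>I. cogrowth E x y n)" if "x \<in> I" for n x
    using that
  proof (induction n arbitrary: x)
    case 0
    have "[] \<in> closing E x x 0" by (simp add: closing_def words_def)
    then have "card (closing E x x 0) > 0" by (auto simp: card_gt_0_iff)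
    then have "1 \<le> cogrowth E x x 0" by (simp add: cogrowth_def)
    also have "\<dots> \<le> (\<Sum>y\<in>I. cogrowth E x y 0)"
      using I 0 by (intro member_le_sum) auto
    finally show ?case by simp
  next
    case (Suc n)
    have "iterate m I (Suc n) x \<le> (\<Sum>v\<in>I. m x v * (\<Sum>y\<in>I. cogrowth E v y n))"
      using Suc.IH m_nonneg by (auto intro!: sum_mono mult_left_mono)
    also have "\<dots> = (\<Sum>y\<in>I. \<Sum>v\<in>I. m x v * cogrowth E v y n)"
      by (subst sum.swap) (simp add: sum_distrib_left)
    also have "\<dots> \<le> (\<Sum>y\<in>I. cogrowth E x y (Suc n))"
      unfolding m_def by (intro sum_mono sum_edges_cogrowth_le E I)
    finally show ?case .
  qed
  then have "(\<Sum>x\<in>I. iterate m I n x) \<le> (\<Sum>x\<in>I. \<Sum>y\<in>I. R ^ n)" for n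
    using bound by (intro sum_mono) (meson order_trans sum_mono)
  then have "(\<Sum>x\<in>I. iterate m I n x) \<le> (card I)\<^sup>2 * R ^ n" for n
    by (simp add: power2_eq_square mult_ac)
  from sum_matrix_le[OF I sym m_nonneg R this]
  have "(\<Sum>x\<in>I. \<Sum>y\<in>I. m x y) \<le> card I * R" .
  also have "(\<Sum>x\<in>I. \<Sum>y\<in>I. m x y) = (\<Sum>l\<in>letters. \<Sum>x\<in>I. \<Sum>y\<in>I. of_bool (edge E x l y))"
    unfolding m_def by (simp only: sum.swap[of _ letters])
  also have "\<dots> = (\<Sum>l\<in>letters. real (card {x \<in> I. \<exists>y\<in>I. edge E x l y}))"
  proof (rule sum.cong[OF refl])
    fix l
    have "(\<Sum>y\<in>I. of_bool (edge E x l y)) = (of_bool (\<exists>y\<in>I. edge E x l y) :: real)" for x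
    proof (cases "\<exists>y\<in>I. edge E x l y")
      case True
      then obtain y where y: "y \<in> I" "edge E x l y" by blast
      have "(\<Sum>v\<in>I. of_bool (edge E x l v)) = (\<Sum>v\<in>I. if v = y then 1 else 0 :: real)"
        using y by (intro sum.cong) (auto dest: foldedD[OF E])
      then show ?thesis using True y I by simp
    qed auto
    then have "(\<Sum>x\<in>I. \<Sum>y\<in>I. of_bool (edge E x l y)) = (\<Sum>x\<in>I. of_bool (\<exists>y\<in>I. edge E x l y) :: real)"
      by simp
    also have "\<dots> = real (card {x \<in> I. \<exists>y\<in>I. edge E x l y})"
      using I by (simp add: sum.inter_filter[symmetric] of_bool_def)
    finally show "(\<Sum>x\<in>I. \<Sum>y\<in>I. of_bool (edge E x l y)) = real (card {x \<in> I. \<exists>y\<in>I. edge E x l y})" .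
  qed
  finally show ?thesis .
qed

end

section \<open>Graphs on the integers\<close>

text \<open>A limsup of \<open>n\<close>-th roots expressed without roots: \<open>\<beta>\<close>
  separates the \<open>c\<close> for which \<open>f n\<close> is dominated by a multiple of
  \<open>c ^ n\<close> from the others, and \<open>c = \<beta>\<close> is left open.\<close>

definition exp_rate :: "(nat \<Rightarrow> real) \<Rightarrow> real \<Rightarrow> bool" where
  "exp_rate f \<beta> \<longleftrightarrow> (\<forall>c>0. (\<beta> < c \<longrightarrow> (\<exists>M. \<forall>n. f n \<le> M * c ^ n)) \<and>
     (c < \<beta> \<longrightarrow> \<not> (\<exists>M. \<forall>n. f n \<le> M * c ^ n)))"

lemma reduced_single_generator:
  assumes "reduced w" "\<And>l. l \<in> set w \<Longrightarrow> fst l = a"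
  shows "\<exists>n c. w = replicate n (a, c)"
  using assms
proof (induction w)
  case (Cons l w)
  have "reduced w" using Cons.prems(1) by (simp add: reduced_Cons)
  from Cons.IH[OF this] Cons.prems(2) obtain n c where c: "w = replicate n (a, c)"
    by (meson list.set_intros(2))
  obtain c' where l: "l = (a, c')" using Cons.prems(2)[of l] by (cases l) auto
  show ?case
  proof (cases n)
    case 0
    then show ?thesis using c l by (intro exI[of _ "Suc 0"] exI[of _ c']) simp
  next
    case (Suc m)
    then have "c' = c"
      using Cons.prems(1) c l by (auto simp: reduced_Cons inv_letter_def)
    then show ?thesis using c l by (intro exI[of _ "Suc n"] exI[of _ c]) simp
  qed
qed simp

section \<open>The integer line, a tree with trivial vertex groups\<close>

definition line :: "'a \<Rightarrow> (int \<times> 'a \<times> int) set" where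
  "line a = {(n, a, n + 1) | n. True}"

lemma edge_line: "edge (line a) x l y \<longleftrightarrow> fst l = a \<and> y = x + (if snd l then 1 else -1)"
  by (auto simp: edge_def line_def)

lemma folded_line: "folded (line a)"
  by (auto simp: folded_def edge_line)

lemma walk_line_fst: "walk (line a) x w y \<Longrightarrow> l \<in> set w \<Longrightarrow> fst l = a"
  by (induction w arbitrary: x) (auto simp: edge_line)

lemma walk_line_replicate:
  "walk (line a) x (replicate n (a, c)) y \<longleftrightarrow> y = x + (if c then 1 else -1) * int n"
  by (induction n arbitrary: x) (auto simp: edge_line)

lemma stab_line_self: "stab S (line a) x x \<subseteq> {[]}"
proof
  fix w assume w: "w \<in> stab S (line a) x x"
  then have walk: "walk (line a) x w x" and "reduced w" by (auto simp: stab_def)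
  from reduced_single_generator[OF this(2) walk_line_fst[OF walk]]
  obtain n c where c: "w = replicate n (a, c)" by blast
  then have "(if c then 1 else -1) * int n = 0"
    using walk by (simp only: walk_line_replicate)
  then show "w \<in> {[]}" using c by (simp split: if_splits)
qed

lemma walk_line_ex: "\<exists>w. set w \<subseteq> {a} \<times> UNIV \<and> walk (line a) x w y"
proof (cases "x \<le> y")
  case True
  then show ?thesis
    by (intro exI[of _ "replicate (nat (y - x)) (a, True)"])
      (auto simp only: walk_line_replicate set_replicate_conv_if split: if_splits)
next
  case False
  then show ?thesis
    by (intro exI[of _ "replicate (nat (x - y)) (a, False)"])
      (auto simp only: walk_line_replicate set_replicate_conv_if split: if_splits)
qed

lemma stab_inv_word: "w \<in> stab S E x y \<Longrightarrow> inv_word w \<in> stab S E y x"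
  by (auto simp: stab_def reduced_inv_word set_inv_word walk_inv_word)

locale line_alphabet = free_alphabet +
  fixes a :: 'a
  assumes a_in_S: "a \<in> S"
begin

text \<open>
  Consecutive blocks are so far apart that a walk of length less than \<open>k\<close> starting in the
  \<open>k\<close>-th block cannot leave it for another block. As \<open>base = 2 * (q + 1)\<close>, the \<open>k\<close>-th block is also
  much larger than a ball of radius \<open>k\<close>, which has at most \<open>(q + 1) ^ k\<close> vertices.
\<close>

definition base :: int where
  "base = 4 * int (card S)"

definition block :: "nat \<Rightarrow> int set" where
  "block k = {base ^ k..<2 * base ^ k}"

definition inner :: "(int \<times> 'a \<times> int) set" where
  "inner = {(x, s, y). s \<in> S - {a} \<and> (\<exists>k. x \<in> block k \<and> y \<in> block k)}"

text \<open>Makes the loops at both ends of a new edge in a far block long, hence of small weight in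
  \<open>sum_power_insert_edge\<close>.\<close>

definition girth_cond :: "(int \<times> 'a \<times> int) set \<Rightarrow> bool" where
  "girth_cond E \<longleftrightarrow> (\<forall>k x w. x \<in> block k \<longrightarrow> w \<in> stab S E x x \<longrightarrow> w \<noteq> [] \<longrightarrow> k \<le> length w)"

text \<open>The bound at the vertex \<open>0\<close> spreads to all pairs of vertices by
  \<open>cogrowth_le_everywhere\<close>, because the line connects them.\<close>

definition admissible :: "real \<Rightarrow> (int \<times> 'a \<times> int) set \<Rightarrow> bool" where
  "admissible R E \<longleftrightarrow> line a \<subseteq> E \<and> E \<subseteq> line a \<union> inner \<and> folded E \<and> girth_cond E \<and>
     (\<forall>n. cogrowth E 0 0 n \<le> R ^ n)"

lemma base_ge_4: "base \<ge> 4"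
  using finite_S nonempty_S by (simp add: base_def Suc_leI card_gt_0_iff)

lemma two_power_le_base_power: "2 * base ^ k + int k \<le> base ^ Suc k"
proof -
  have "int k \<le> 2 * base ^ k"
  proof (induction k)
    case (Suc k)
    have "1 \<le> base ^ k" using base_ge_4 by simp
    then have "int (Suc k) \<le> 4 * (2 * base ^ k)" using Suc by simp
    also have "\<dots> \<le> base * (2 * base ^ k)"
      using base_ge_4 by (intro mult_right_mono) auto
    finally show ?case by simp
  qed simp
  moreover have "4 * base ^ k \<le> base * base ^ k"
    using base_ge_4 by (intro mult_right_mono) auto
  ultimately show ?thesis by simp
qed

text \<open>By \<open>two_power_le_base_power\<close>, at least \<open>k\<close> integers separate
  the \<open>k\<close>-th block from the next and at least \<open>k - 1\<close> from the previous
  one, so \<open>i < k\<close> steps bridge neither gap.\<close>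

lemma block_gap:
  assumes "v \<in> block j" "i < k" "base ^ k - int i \<le> v" "v < 2 * base ^ k + int i"
  shows "j = k"
proof (rule ccontr)
  assume "j \<noteq> k"
  then consider "j < k" | "k < j" by linarith
  then show False
  proof cases
    case 1
    then obtain k' where k: "k = Suc k'" by (cases k) auto
    have "base ^ j \<le> base ^ k'"
      using 1 k base_ge_4 by (intro power_increasing) auto
    then have "v < base ^ k - int k'"
      using assms(1) two_power_le_base_power[of k'] k by (simp add: block_def)
    then show False using assms(2,3) k by simp
  next
    case 2
    have "base ^ Suc k \<le> base ^ j"
      using 2 base_ge_4 by (intro power_increasing) auto
    then show False
      using assms two_power_le_base_power[of k] by (simp add: block_def)
  qed
qed

lemma block_disjoint: "x \<in> block j \<Longrightarrow> x \<in> block k \<Longrightarrow> j = k"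
proof (induction j k rule: linorder_wlog)
  case (le j k)
  show ?case
  proof (cases "k = 0")
    case False
    then show ?thesis using le block_gap[of x j 0 k] by (simp add: block_def)
  qed (use le in simp)
qed simp

lemma finite_block [simp]: "finite (block k)"
  by (simp add: block_def)

lemma card_block: "real (card (block k)) = real_of_int base ^ k"
  using base_ge_4 by (simp add: block_def)

lemma real_base: "real_of_int base = 2 * (q + 1)"
  by (simp add: base_def q_def)

section \<open>The hypotheses of Zorn's lemma\<close>

lemma admissible_line:
  assumes "0 < z" "z \<le> 1"
  shows "admissible (rate z) (line a)"
proof -
  have "cogrowth (line a) 0 0 n \<le> rate z ^ n" for n
  proof (rule cogrowth_le_of_sum_power[OF folded_line assms])
    fix T assume "T \<subseteq> stab S (line a) (0 :: int) 0"
    then have "T \<subseteq> {[]}" using stab_line_self by (rule order_trans)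
    then show "(\<Sum>w\<in>T. z ^ length w) \<le> 1" by (auto simp: subset_singleton_iff)
  qed
  moreover have "girth_cond (line a)"
    using stab_line_self by (fastforce simp: girth_cond_def)
  ultimately show ?thesis
    by (simp add: admissible_def folded_line)
qed

text \<open>Folding, girth and the count at a fixed \<open>n\<close> each concern finitely many
  edges at a time, so a violation in the union would already occur in one member of the
  chain.\<close>

lemma admissible_Union_chain:
  assumes "\<C> \<noteq> {}" and chain: "subset.chain {E. admissible R E} \<C>"
  shows "admissible R (\<Union>\<C>)"
proof -
  have adm: "admissible R E" if "E \<in> \<C>" for E
    using that chain by (auto simp: subset.chain_def)
  have "folded (\<Union>\<C>)"
    using adm by (intro folded_Union_chain[OF chain]) (auto simp: admissible_def)
  moreover have "girth_cond (\<Union>\<C>)"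
    unfolding girth_cond_def
  proof (intro allI impI)
    fix k x w assume x: "x \<in> block k" and w: "w \<in> stab S (\<Union>\<C>) x x" "w \<noteq> []"
    then obtain E where "E \<in> \<C>" "w \<in> stab S E x x"
      using walk_Union_chain[OF chain assms(1), of x w x] by (auto simp: stab_def)
    then show "k \<le> length w"
      using x w(2) adm by (auto simp: admissible_def girth_cond_def)
  qed
  moreover have "cogrowth (\<Union>\<C>) 0 0 n \<le> R ^ n" for n
  proof -
    let ?\<B> = "(\<lambda>E. closing E 0 0 n) ` \<C>"
    have mono: "closing E 0 0 n \<subseteq> closing E' 0 0 n" if "E \<subseteq> E'" for E E' :: "(int \<times> 'a \<times> int) set"
      using walk_mono[OF _ that] by (auto simp: closing_def)
    have "closing E 0 0 n \<subseteq> closing E' 0 0 n \<or> closing E' 0 0 n \<subseteq> closing E 0 0 n"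
      if "E \<in> \<C>" "E' \<in> \<C>" for E E'
      using chain that mono[of E E'] mono[of E' E] by (auto simp only: subset_chain_def)
    then have "subset.chain UNIV ?\<B>"
      by (simp add: subset_chain_def)
    moreover have "closing (\<Union>\<C>) 0 0 n \<subseteq> \<Union>?\<B>"
    proof
      fix w assume w: "w \<in> closing (\<Union>\<C>) 0 0 n"
      then obtain E where "E \<in> \<C>" "walk E 0 (reduce_word w) 0"
        using walk_Union_chain[OF chain assms(1), of 0 "reduce_word w" 0] by (auto simp: closing_def)
      then show "w \<in> \<Union>?\<B>" using w by (auto simp: closing_def)
    qed
    moreover have "?\<B> \<noteq> {}" using assms(1) by simp
    ultimately obtain B where "B \<in> ?\<B>" "closing (\<Union>\<C>) 0 0 n \<subseteq> B"
      using finite_subset_Union_chain[OF finite_closing] by metis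
    then obtain E where "E \<in> \<C>" "closing (\<Union>\<C>) 0 0 n \<subseteq> closing E 0 0 n" by blast
    then have "cogrowth (\<Union>\<C>) 0 0 n \<le> cogrowth E 0 0 n" "cogrowth E 0 0 n \<le> R ^ n"
      using adm by (auto simp: cogrowth_def admissible_def card_mono)
    then show ?thesis by simp
  qed
  moreover have "line a \<subseteq> \<Union>\<C>"
    using adm assms(1) unfolding admissible_def by blast
  moreover have "\<Union>\<C> \<subseteq> line a \<union> inner"
    using adm unfolding admissible_def by (intro Union_least) blast
  ultimately show ?thesis by (simp add: admissible_def)
qed

section \<open>Keeping cycles long when an edge is added\<close>

lemma edge_near_block:
  assumes E: "E \<subseteq> line a \<union> inner" and e: "edge E v l v'"
    and v: "i < k" "base ^ k - int i \<le> v" "v < 2 * base ^ k + int i"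
  shows "base ^ k - int (Suc i) \<le> v'" "v' < 2 * base ^ k + int (Suc i)"
proof -
  have "edge (line a) v l v' \<or> (\<exists>j. v \<in> block j \<and> v' \<in> block j)"
    using E e by (auto simp: edge_def inner_def split: if_splits)
  then have "base ^ k - int (Suc i) \<le> v' \<and> v' < 2 * base ^ k + int (Suc i)"
  proof (elim disjE exE conjE)
    fix j assume "v \<in> block j" "v' \<in> block j"
    moreover from this have "j = k" using v block_gap by blast
    ultimately show ?thesis by (simp add: block_def)
  qed (use v in \<open>auto simp: edge_line\<close>)
  then show "base ^ k - int (Suc i) \<le> v'" "v' < 2 * base ^ k + int (Suc i)" by auto
qed

text \<open>\<open>i\<close> bounds the distance from the \<open>k\<close>-th block: a line edge
  raises it by at most one, and any other edge met before the budget \<open>k\<close> is used up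
  lies in the \<open>k\<close>-th block itself. So the new edge in block \<open>j\<close> is never
  reached.\<close>

lemma walk_insert_other_block:
  assumes E: "E \<subseteq> line a \<union> inner" and xy: "s \<in> S - {a}" "x \<in> block j" "y \<in> block j" "j \<noteq> k"
    and "i + length w \<le> k" "base ^ k - int i \<le> v" "v < 2 * base ^ k + int i"
    and "walk (insert (x, s, y) E) v w v'"
  shows "walk E v w v'"
  using assms(6-9)
proof (induction w arbitrary: v i)
  case (Cons l w)
  then obtain p where p: "edge (insert (x, s, y) E) v l p" "walk (insert (x, s, y) E) p w v'" by auto
  have i: "i < k" using Cons.prems(1) by simp
  have "v \<notin> block j"
    using block_gap[of v j i k] Cons.prems(2,3) i xy(4) by blast
  then have e: "edge E v l p"
    using p(1) xy by (auto simp: edge_def split: if_splits)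
  have "walk E p w v'"
    using Cons.prems(1) edge_near_block[OF E e i Cons.prems(2,3)] p(2)
    by (intro Cons.IH[of "Suc i"]) auto
  then show ?case using e by auto
qed simp

text \<open>A short new cycle must use the new edge. If the rest of it lies in \<open>E\<close>,
  rotating it gives a short path between \<open>x\<close> and \<open>y\<close>; otherwise the piece
  between the first two uses is such a path or a short cycle of \<open>E\<close>.\<close>

lemma girth_cond_insert:
  assumes E: "E \<subseteq> line a \<union> inner" "folded E" "girth_cond E"
    and xy: "s \<in> S - {a}" "x \<in> block j" "y \<in> block j"
    and sep: "\<And>w. w \<in> stab S E x y \<Longrightarrow> j \<le> length w"
  shows "girth_cond (insert (x, s, y) E)"
  unfolding girth_cond_def
proof (intro allI impI)
  let ?F = "insert (x, s, y) E"
  fix k v w assume v: "v \<in> block k" and w: "w \<in> stab S ?F v v" "w \<noteq> []"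
  show "k \<le> length w"
  proof (rule ccontr)
    assume len: "\<not> k \<le> length w"
    have noE: "\<not> walk E v w v"
      using E(3) v w len unfolding girth_cond_def stab_def by blast
    have wF: "walk ?F v w v" "reduced w" "set w \<subseteq> letters" using w by (auto simp: stab_def)
    show False
    proof (cases "j = k")
      case False
      then show False
        using walk_insert_other_block[OF E(1) xy False, of 0 w v v] v wF(1) len noE
        by (simp add: block_def)
    next
      case True
      define src where "src c = (if c then x else y)" for c
      define dst where "dst c = (if c then y else x)" for c
      have sep': "k \<le> length u" if "reduced u" "set u \<subseteq> letters" "walk E (dst c) u (src c)" for u c
        using sep[of u] sep[of "inv_word u"] stab_inv_word[of u S E y x] that True
        by (cases c) (auto simp: src_def dst_def stab_def)
      obtain w1 c w2 where d: "w = w1 @ (s, c) # w2" "walk E v w1 (src c)" "walk ?F (dst c) w2 v"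
        using wF(1)
      proof (cases rule: walk_insertE)
        case (2 w1 c w2)
        then show ?thesis using that[of w1 c w2] by (simp add: src_def dst_def)
      qed (use noE in blast)
      from d(3) show False
      proof (cases rule: walk_insertE)
        case 1
        \<comment> \<open>One crossing only: the cycle is read from the far end of the new edge, and
          reduction can only shorten it.\<close>
        have "k \<le> length (reduce_word (w2 @ w1))"
        proof (rule sep'[OF reduced_reduce_word])
          show "set (reduce_word (w2 @ w1)) \<subseteq> letters"
            using wF(3) d(1) by (intro set_reduce_word_subset) auto
          show "walk E (dst c) (reduce_word (w2 @ w1)) (src c)"
            using 1 d(2) by (intro walk_reduce_word E(2)) (auto simp: walk_append)
        qed
        then show False
          using length_reduce_word[of "w2 @ w1"] d(1) len by simp
      next
        case (2 u c' w3)
        have red: "reduced ((s, c) # u @ (s, c') # w3)"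
          using wF(2) d(1) 2(1) reduced_appendD[of w1 "(s, c) # u @ (s, c') # w3"] by simp
        then have "reduced u"
          using reduced_appendD[of u "(s, c') # w3"] by (simp only: reduced_Cons)
        moreover have "set u \<subseteq> letters" using wF(3) d(1) 2(1) by simp
        moreover have "walk E (dst c) u (src c')" using 2(2) by (simp add: src_def)
        ultimately have u: "reduced u" "set u \<subseteq> letters" "walk E (dst c) u (src c')" .
        show False
        proof (cases "c' = c")
          case True
          then show False using sep'[of u c] u 2(1) d(1) len by simp
        next
          case False
          then have "src c' = dst c" by (simp add: src_def dst_def)
          then have "u \<in> stab S E (dst c) (dst c)" using u by (simp add: stab_def)
          moreover have "dst c \<in> block k" using xy True by (simp add: dst_def)
          \<comment> \<open>The two crossings have opposite directions, so an empty \<open>u\<close>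
            would contradict that \<open>w\<close> is reduced.\<close>
          moreover have "u \<noteq> []"
          proof
            assume "u = []"
            then show False using red False by (simp add: reduced_Cons inv_letter_def)
          qed
          ultimately have "k \<le> length u" using E(3) unfolding girth_cond_def by blast
          then show False using 2(1) d(1) len by simp
        qed
      qed
    qed
  qed
qed

lemma stab_subset_exp_bound:
  assumes "0 < z" "0 \<le> M" "0 < \<sigma>" "\<sigma> * z < 1"
    and bound: "\<And>n. real (card {w \<in> stab S E x y. length w = n}) \<le> M * \<sigma> ^ n"
    and T: "finite T" "T \<subseteq> stab S E x y"
  shows "(\<Sum>w\<in>T. z ^ length w) \<le> M / (1 - \<sigma> * z)"
proof -
  define N where "N = Max (length ` T)"
  have fin: "finite {w \<in> stab S E x y. length w = n}" for n
    by (rule finite_subset[OF _ finite_length_le[of n]]) (auto simp: stab_def)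
  have "(\<Sum>w\<in>T. z ^ length w) = (\<Sum>n\<le>N. \<Sum>w\<in>{w \<in> T. length w = n}. z ^ length w)"
    using T(1) by (intro sum.group[symmetric]) (auto simp: N_def)
  also have "\<dots> \<le> (\<Sum>n\<le>N. M * (\<sigma> * z) ^ n)"
  proof (rule sum_mono)
    fix n
    have "(\<Sum>w\<in>{w \<in> T. length w = n}. z ^ length w) = real (card {w \<in> T. length w = n}) * z ^ n"
      by simp
    also have "\<dots> \<le> (M * \<sigma> ^ n) * z ^ n"
    proof (rule mult_right_mono)
      have "card {w \<in> T. length w = n} \<le> card {w \<in> stab S E x y. length w = n}"
        using T(2) by (intro card_mono fin) auto
      then show "real (card {w \<in> T. length w = n}) \<le> M * \<sigma> ^ n"
        using bound[of n] by linarith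
    qed (use assms in simp)
    finally show "(\<Sum>w\<in>{w \<in> T. length w = n}. z ^ length w) \<le> M * (\<sigma> * z) ^ n"
      by (simp add: power_mult_distrib mult_ac)
  qed
  also have "\<dots> = M * (\<Sum>n\<le>N. (\<sigma> * z) ^ n)" by (simp add: sum_distrib_left)
  also have "\<dots> \<le> M * (\<Sum>n. (\<sigma> * z) ^ n)"
    using assms by (intro mult_left_mono sum_le_suminf summable_geometric) auto
  also have "\<dots> = M / (1 - \<sigma> * z)"
    using assms suminf_geometric[of "\<sigma> * z"] by simp
  finally show ?thesis .
qed

lemma admissible_reach:
  assumes "admissible R E"
  shows "\<exists>w. set w \<subseteq> letters \<and> walk E 0 w x"
proof -
  obtain w where w: "set w \<subseteq> {a} \<times> UNIV" "walk (line a) 0 w x"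
    using walk_line_ex[of a 0 x] by (elim exE conjE)
  have "walk E 0 w x"
    using w(2) assms by (intro walk_mono[OF w(2)]) (simp add: admissible_def)
  moreover have "set w \<subseteq> letters" using w(1) a_in_S by auto
  ultimately show ?thesis by (intro exI conjI)
qed

end

section \<open>Saturated graphs\<close>

context line_alphabet begin

text \<open>Growth below \<open>\<alpha>\<close> leaves room between \<open>1 / \<alpha>\<close> and
  \<open>1 / \<sigma>\<close>, which pays for one edge between vertices that are far apart in a far
  block.\<close>

lemma admissible_insert:
  fixes \<alpha> \<sigma> M :: real
  assumes E: "admissible (rate (1 / \<alpha>)) E" and \<sigma>: "q < \<sigma>\<^sup>2" "0 < \<sigma>" "\<sigma> < \<alpha>"
    and bound: "\<And>n. real (card {w \<in> stab S E 0 0. length w = n}) \<le> M * \<sigma> ^ n"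
  shows "\<exists>k0. \<forall>k\<ge>k0. \<forall>x\<in>block k. \<forall>y\<in>block k. \<forall>s\<in>S - {a}.
    (\<nexists>v. edge E x (s, True) v) \<longrightarrow> (\<nexists>v. edge E y (s, False) v) \<longrightarrow>
    (\<forall>w\<in>stab S E x y. k \<le> length w) \<longrightarrow> admissible (rate (1 / \<alpha>)) (insert (x, s, y) E)"
proof -
  have sub: "line a \<subseteq> E" "E \<subseteq> line a \<union> inner" and fold: "folded E" and girth: "girth_cond E"
    using E by (auto simp: admissible_def)
  have \<sigma>1: "1 < \<sigma>"
  proof (rule ccontr)
    assume "\<not> 1 < \<sigma>"
    then have "\<sigma>\<^sup>2 \<le> 1" using \<sigma>(2) by (simp add: power_le_one)
    then show False using \<sigma>(1) q_ge_1 by simp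
  qed
  have M: "M \<ge> 0" using bound[of 0] by simp
  have inv: "1 / \<alpha> < 1 / \<sigma>" using \<sigma> by (simp add: field_simps)
  \<comment> \<open>Three numbers for three losses: at \<open>z0\<close> the series of the base
    vertex converges, a uniform bound for all pairs of vertices holds at \<open>z1\<close>, and at
    \<open>z2\<close> long words have small total weight.\<close>
  then obtain z2 where z2: "1 / \<alpha> < z2" "z2 < 1 / \<sigma>" using dense by blast
  then obtain z1 where z1: "z2 < z1" "z1 < 1 / \<sigma>" using dense by blast
  then obtain z0 where z0: "z1 < z0" "z0 < 1 / \<sigma>" using dense by blast
  have "0 < 1 / \<alpha>" using \<sigma> by simp
  then have pos: "0 < z2" "0 < z1" "0 < z0" using z2 z1 z0 by linarith+
  have "1 / \<sigma> < 1" using \<sigma>1 by simp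
  then have le1: "z2 \<le> 1" "z1 \<le> 1" "z0 \<le> 1" using z2 z1 z0 by linarith+
  have small: "q * u * v < 1" if "0 < u" "0 < v" "u < 1 / \<sigma>" "v < 1 / \<sigma>" for u v
  proof -
    have "u * v \<le> 1 / \<sigma> * (1 / \<sigma>)" using that \<sigma> by (intro mult_mono) auto
    then have "q * (u * v) \<le> q * (1 / \<sigma> * (1 / \<sigma>))" using q_ge_1 by (intro mult_left_mono) auto
    also have "\<dots> < 1" using \<sigma> by (simp add: field_simps power2_eq_square)
    finally show ?thesis by (simp add: mult_ac)
  qed
  have r01: "rate z0 < rate z1" and r2: "rate z2 \<le> rate (1 / \<alpha>)"
    using rate_strict_antimono[of z1 z0] rate_strict_antimono[of "1 / \<alpha>" z2] small[of z1 z0]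
      small[of "1 / \<alpha>" z2] z0 z1 z2 pos inv \<open>0 < 1 / \<alpha>\<close> by auto
  have "cogrowth E 0 0 n \<le> rate z0 ^ n" for n
  proof (rule cogrowth_le_of_sum_power[OF fold pos(3) le1(3)])
    fix T assume T: "finite T" "T \<subseteq> stab S E 0 0"
    have "\<sigma> * z0 < 1" using z0(2) \<sigma>(2) by (simp add: field_simps)
    then show "(\<Sum>w\<in>T. z0 ^ length w) \<le> M / (1 - \<sigma> * z0)"
      using stab_subset_exp_bound[OF pos(3) M \<sigma>(2) _ bound T] by simp
  qed
  then have cog: "cogrowth E x y n \<le> rate z0 ^ n" for x y n
    by (rule cogrowth_le_everywhere[OF fold rate_pos[OF pos(3)] _ admissible_reach[OF E]])
  define C where "C = 1 / (1 - rate z0 / rate z1)"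
  have sum1: "(\<Sum>w\<in>T. z1 ^ length w) \<le> C" if "finite T" "T \<subseteq> stab S E u v" for T u v
    unfolding C_def
    by (rule sum_power_le_of_cogrowth[OF pos(2) _ r01 _ cog that])
      (use small[of z1 z1] pos z1 rate_pos[OF pos(3)] in \<open>simp_all add: power2_eq_square mult_ac\<close>)
  have C: "C \<ge> 0" using sum1[of "{}" 0 0] by simp
  have sum2: "(\<Sum>w\<in>T. z2 ^ length w) \<le> C" if "finite T" "T \<subseteq> stab S E u v" for T u v
  proof -
    have "(\<Sum>w\<in>T. z2 ^ length w) \<le> (\<Sum>w\<in>T. z1 ^ length w)"
      using pos z1 by (intro sum_mono power_mono) auto
    then show ?thesis using sum1[OF that] by linarith
  qed
  have tail: "(\<Sum>w\<in>T. z2 ^ length w) \<le> (z2 / z1) ^ k * C"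
    if "finite T" "T \<subseteq> stab S E u v" "\<And>w. w \<in> T \<Longrightarrow> k \<le> length w" for T u v k
  proof -
    have "(\<Sum>w\<in>T. z2 ^ length w) \<le> (\<Sum>w\<in>T. (z2 / z1) ^ k * z1 ^ length w)"
    proof (rule sum_mono)
      fix w assume "w \<in> T"
      have "z2 ^ length w = (z2 / z1) ^ length w * z1 ^ length w"
        using pos by (simp add: power_divide)
      also have "\<dots> \<le> (z2 / z1) ^ k * z1 ^ length w"
        using pos z1 that(3)[OF \<open>w \<in> T\<close>] by (intro mult_right_mono power_decreasing) auto
      finally show "z2 ^ length w \<le> (z2 / z1) ^ k * z1 ^ length w" .
    qed
    also have "\<dots> = (z2 / z1) ^ k * (\<Sum>w\<in>T. z1 ^ length w)" by (simp add: sum_distrib_left)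
    also have "\<dots> \<le> (z2 / z1) ^ k * C"
      using sum1[OF that(1,2)] pos by (intro mult_left_mono) auto
    finally show ?thesis .
  qed
  \<comment> \<open>\<open>(z2 / z1) ^ k * C\<close> will serve as \<open>\<epsilon>\<close> in
    \<open>sum_power_insert_edge\<close>; it tends to \<open>0\<close>, which supplies the threshold
    \<open>k1\<close>.\<close>
  have "(\<lambda>k. 4 * z2 * ((z2 / z1) ^ k * C)) \<longlonglongrightarrow> 4 * z2 * (0 * C)"
    using pos z1 by (intro tendsto_intros LIMSEQ_realpow_zero) auto
  then have "eventually (\<lambda>k. 4 * z2 * ((z2 / z1) ^ k * C) < 1) sequentially"
    by (rule order_tendstoD) simp
  then obtain k1 where k1: "\<And>k. k \<ge> k1 \<Longrightarrow> 4 * z2 * ((z2 / z1) ^ k * C) < 1"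
    by (auto simp: eventually_sequentially)
  show ?thesis
  proof (intro exI[of _ "max k1 1"] allI ballI impI)
    fix k x y s
    assume k: "k \<ge> max k1 1" and xy: "x \<in> block k" "y \<in> block k" "s \<in> S - {a}"
      and free: "\<nexists>v. edge E x (s, True) v" "\<nexists>v. edge E y (s, False) v"
      and sep: "\<forall>w\<in>stab S E x y. k \<le> length w"
    let ?F = "insert (x, s, y) E"
    have F: "folded ?F" using folded_insert[OF fold free] .
    \<comment> \<open>For \<open>x = y\<close> the empty word would violate the separation, as
      \<open>k \<ge> 1\<close>; hence the threshold \<open>max k1 1\<close>.\<close>
    have ne: "x \<noteq> y"
    proof
      assume "x = y"
      then have "[] \<in> stab S E x y" by (simp add: stab_def)
      then show False using sep k by fastforce
    qed
    have long: "k \<le> length w" if w: "w \<in> stab S E u v" "w \<noteq> []" and uv: "u \<in> {x, y}" "v \<in> {x, y}" for u v w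
    proof (cases "u = v")
      case True
      then have "u \<in> block k" "w \<in> stab S E u u" using w uv xy by auto
      then show ?thesis using girth w(2) unfolding girth_cond_def by blast
    next
      case False
      then have "w \<in> stab S E x y \<or> inv_word w \<in> stab S E x y"
        using w(1) uv stab_inv_word[of w S E u v] by auto
      then show ?thesis using sep by (metis length_inv_word)
    qed
    have "cogrowth ?F 0 0 n \<le> rate z2 ^ n" for n
    proof (rule cogrowth_le_of_sum_power[OF F pos(1) le1(1)])
      fix T assume T: "finite T" "T \<subseteq> stab S ?F 0 0"
      show "(\<Sum>w\<in>T. z2 ^ length w) \<le> C + 4 * z2 * C * C"
      proof (rule sum_power_insert_edge[OF pos(1) ne _ sum2 _ T])
        show "4 * z2 * ((z2 / z1) ^ k * C) \<le> 1" using k1[of k] k by simp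
        fix u v U assume uv: "u \<in> {x, y}" "v \<in> {x, y}" and U: "finite U" "U \<subseteq> stab S E u v" "[] \<notin> U"
        have "k \<le> length w" if "w \<in> U" for w
          using long[OF _ _ uv, of w] U that by (metis subsetD)
        then show "(\<Sum>w\<in>U. z2 ^ length w) \<le> (z2 / z1) ^ k * C"
          by (rule tail[OF U(1,2)])
      qed
    qed
    also have "rate z2 ^ n \<le> rate (1 / \<alpha>) ^ n" for n
      using r2 rate_pos[OF pos(1)] by (intro power_mono) auto
    finally have "cogrowth ?F 0 0 n \<le> rate (1 / \<alpha>) ^ n" for n .
    moreover have "girth_cond ?F"
      using sep by (intro girth_cond_insert[OF sub(2) fold girth xy(3,1,2)]) blast
    moreover have "(x, s, y) \<in> inner" using xy by (auto simp: inner_def)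
    ultimately show "admissible (rate (1 / \<alpha>)) ?F"
      using sub F by (auto simp: admissible_def)
  qed
qed

section \<open>Counting the missing edges of a far block\<close>

lemma card_short_words: "real (card {w. set w \<subseteq> letters \<and> length w < k}) \<le> (q + 1) ^ k"
proof (induction k)
  case (Suc k)
  have "{w. set w \<subseteq> letters \<and> length w < Suc k} = {w. set w \<subseteq> letters \<and> length w < k} \<union> words k"
    by (auto simp: words_def)
  then have "card {w. set w \<subseteq> letters \<and> length w < Suc k} \<le>
      card {w. set w \<subseteq> letters \<and> length w < k} + card (words k)"
    by (simp add: card_Un_le)
  then have "real (card {w. set w \<subseteq> letters \<and> length w < Suc k}) \<le> 2 * (q + 1) ^ k"
    using Suc card_words[of k] by linarith
  also have "\<dots> \<le> (q + 1) * (q + 1) ^ k"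
    using q_ge_1 by (intro mult_right_mono) auto
  finally show ?case by simp
qed simp

text \<open>Foldedness lets a word determine its endpoint, so a ball around \<open>x\<close> has no
  more vertices than there are short words.\<close>

lemma card_near_le:
  assumes "folded E" "\<And>y. y \<in> Y \<Longrightarrow> \<exists>w\<in>stab S E x y. length w < k"
  shows "real (card Y) \<le> (q + 1) ^ k"
proof -
  let ?W = "{w. set w \<subseteq> letters \<and> length w < k}"
  obtain f where f: "\<And>y. y \<in> Y \<Longrightarrow> f y \<in> stab S E x y \<and> length (f y) < k"
    using assms(2) by metis
  have "inj_on f Y"
  proof (rule inj_onI)
    fix y z assume "y \<in> Y" "z \<in> Y" "f y = f z"
    then have "walk E x (f y) y" "walk E x (f y) z"
      using f[of y] f[of z] by (auto simp: stab_def)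
    then show "y = z" by (rule walk_det[OF assms(1)])
  qed
  moreover have "f ` Y \<subseteq> ?W" using f by (auto simp: stab_def)
  moreover have "finite ?W"
    by (rule finite_subset[OF _ finite_length_le[of k]]) auto
  ultimately have "card Y \<le> card ?W" by (rule card_inj_on_le)
  then show ?thesis using card_short_words[of k] by linarith
qed

text \<open>If some vertex \<open>x\<close> lacks its outgoing \<open>s\<close>-edge, saturation
  puts all vertices that lack an incoming one into a ball around \<open>x\<close>. Equally many
  vertices lack either kind, so both kinds are few. For the generator \<open>a\<close>, only one end
  of the interval is lost.\<close>

lemma card_saturated_block:
  assumes E: "folded E" "E \<subseteq> line a \<union> inner" "line a \<subseteq> E"
    and sat: "\<And>x y s. x \<in> block k \<Longrightarrow> y \<in> block k \<Longrightarrow> s \<in> S - {a} \<Longrightarrow>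
      \<nexists>v. edge E x (s, True) v \<Longrightarrow> \<nexists>v. edge E y (s, False) v \<Longrightarrow>
      \<exists>w\<in>stab S E x y. length w < k"
    and l: "l \<in> letters"
  shows "real (card (block k)) - (q + 1) ^ k \<le> card {x \<in> block k. \<exists>y\<in>block k. edge E x l y}"
proof -
  define G where "G l = {x \<in> block k. \<exists>y\<in>block k. edge E x l y}" for l
  have finG: "finite (G l)" for l by (simp add: G_def)
  obtain s c where lsc: "l = (s, c)" by (cases l)
  have "real (card (block k)) - (q + 1) ^ k \<le> card (G l)"
  proof (cases "s = a")
    case True
    have "edge E x l (x + (if c then 1 else -1))" for x
      by (rule edge_mono[OF _ E(3)]) (use True lsc in \<open>simp add: edge_line\<close>)
    then have "block k - {if c then 2 * base ^ k - 1 else base ^ k} \<subseteq> G l"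
      by (fastforce simp: G_def block_def split: if_splits)
    from card_mono[OF finG this] have "card (block k) \<le> card (G l) + 1"
      by (simp add: card_Diff_singleton_if split: if_splits)
    moreover have "1 \<le> (q + 1) ^ k" using q_ge_1 by simp
    ultimately show ?thesis by linarith
  next
    case False
    then have s: "s \<in> S - {a}" using l lsc by simp
    \<comment> \<open>An edge not labelled \<open>a\<close> never leaves its block, so lacking an
      \<open>s\<close>-edge inside the block is lacking it altogether.\<close>
    have inblock: "v \<in> block k" if "edge E x (s, b) v" "x \<in> block k" for x v b
    proof -
      have "(x, s, v) \<in> E \<or> (v, s, x) \<in> E"
        using that(1) by (auto simp: edge_def split: if_splits)
      then have "(x, s, v) \<in> line a \<union> inner \<or> (v, s, x) \<in> line a \<union> inner"
        using E(2) by blast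
      then obtain j where "x \<in> block j" "v \<in> block j"
        using False by (auto simp: inner_def line_def)
      then show ?thesis using block_disjoint that(2) by blast
    qed
    define X where "X b = block k - G (s, b)" for b
    have X: "\<nexists>v. edge E x (s, b) v" "x \<in> block k" if "x \<in> X b" for x b
      using that inblock[of x b] by (auto simp: X_def G_def)
    \<comment> \<open>The \<open>s\<close>-edges inside the block match their sources with their
      targets.\<close>
    have "card (G (s, True)) = card (G (s, False))"
    proof -
      have "\<forall>x\<in>G (s, True). \<exists>y. y \<in> block k \<and> edge E x (s, True) y"
        by (auto simp: G_def)
      from bchoice[OF this] obtain f
        where f: "\<And>x. x \<in> G (s, True) \<Longrightarrow> f x \<in> block k \<and> edge E x (s, True) (f x)"
        by blast
      have swap: "edge E x (s, True) y \<longleftrightarrow> edge E y (s, False) x" for x y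
        by (simp add: edge_def)
      have "bij_betw f (G (s, True)) (G (s, False))"
        unfolding bij_betw_def
      proof
        show "inj_on f (G (s, True))"
        proof (rule inj_onI)
          fix x y assume "x \<in> G (s, True)" "y \<in> G (s, True)" "f x = f y"
          then have "edge E (f x) (s, False) x" "edge E (f x) (s, False) y"
            using f[of x] f[of y] by (simp_all add: swap)
          then show "x = y" by (rule foldedD[OF E(1)])
        qed
        show "f ` G (s, True) = G (s, False)"
        proof (intro equalityI subsetI)
          fix y assume "y \<in> f ` G (s, True)"
          then obtain x where "x \<in> G (s, True)" "y = f x" by blast
          then show "y \<in> G (s, False)"
            using f[of x] swap[of x "f x"] by (auto simp: G_def)
        next
          fix y assume "y \<in> G (s, False)"
          then obtain x where x: "x \<in> block k" "edge E x (s, True) y" "y \<in> block k"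
            using swap by (auto simp: G_def)
          then have "x \<in> G (s, True)" by (auto simp: G_def)
          moreover from this have "f x = y" using foldedD[OF E(1), of x "(s, True)" "f x" y] f[of x] x(2) by simp
          ultimately show "y \<in> f ` G (s, True)" by blast
        qed
      qed
      then show ?thesis by (rule bij_betw_same_card)
    qed
    moreover have cardX: "card (X b) = card (block k) - card (G (s, b))" for b
      unfolding X_def by (rule card_Diff_subset[OF finG]) (auto simp: G_def)
    ultimately have eq: "card (X True) = card (X False)" by simp
    have "real (card (X True)) \<le> (q + 1) ^ k"
    proof (cases "X True = {}")
      case True
      then show ?thesis using q_ge_1 by simp
    next
      case False
      then obtain x where "x \<in> X True" by blast
      have "real (card (X False)) \<le> (q + 1) ^ k"
      proof (rule card_near_le[OF E(1)])
        fix y assume "y \<in> X False"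
        then show "\<exists>w\<in>stab S E x y. length w < k"
          using \<open>x \<in> X True\<close> X s sat by blast
      qed
      then show ?thesis using eq by simp
    qed
    then have "real (card (X c)) \<le> (q + 1) ^ k" using eq by (cases c) auto
    then show ?thesis using cardX[of c] unfolding lsc by linarith
  qed
  then show ?thesis by (simp add: G_def)
qed

text \<open>Admissibility gives the upper bound through the cogrowth formula,
  \<open>1 / \<alpha>\<close> lying on the decreasing branch of \<open>rate\<close>; the lower bound
  comes from maximality.\<close>

lemma ex_folded_exp_rate:
  assumes \<alpha>: "q < \<alpha>\<^sup>2" "1 < \<alpha>" "\<alpha> < q"
  shows "\<exists>E :: (int \<times> 'a \<times> int) set. folded E \<and>
    exp_rate (\<lambda>n. real (card {w \<in> stab S E 0 0. length w = n})) \<alpha>"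
proof -
  define R where "R = rate (1 / \<alpha>)"
  have R: "R = \<alpha> + q / \<alpha>" by (simp add: R_def rate_def)
  have R0: "R > 0" unfolding R_def using \<alpha> by (intro rate_pos) simp
  have "admissible R (line a)"
    unfolding R_def using \<alpha> by (intro admissible_line) auto
  then have "\<exists>E\<in>{E. admissible R E}. \<forall>F\<in>{E. admissible R E}. E \<subseteq> F \<longrightarrow> F = E"
    using admissible_Union_chain by (intro subset_Zorn_nonempty) auto
  then obtain E where E: "admissible R E" and max: "\<And>F. admissible R F \<Longrightarrow> E \<subseteq> F \<Longrightarrow> F = E"
    by blast
  have sub: "line a \<subseteq> E" "E \<subseteq> line a \<union> inner" and fold: "folded E" and cog0: "\<And>n. cogrowth E 0 0 n \<le> R ^ n"
    using E by (auto simp: admissible_def)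
  have cog: "cogrowth E x y n \<le> R ^ n" for x y n
    by (rule cogrowth_le_everywhere[OF fold R0 cog0 admissible_reach[OF E]])
  define f where "f n = real (card {w \<in> stab S E 0 0. length w = n})" for n
  have fin: "finite {w \<in> stab S E 0 0. length w = n}" for n
    by (rule finite_subset[OF _ finite_length_le[of n]]) (auto simp: stab_def)
  have "\<exists>M. \<forall>n. f n \<le> M * c ^ n" if "\<alpha> < c" for c
  proof -
    have c: "0 < c" using that \<alpha> by simp
    have "q < c * \<alpha>"
      using \<alpha>(1,2) mult_strict_right_mono[OF that, of \<alpha>] unfolding power2_eq_square by linarith
    then have q1: "q * (1 / c) * (1 / \<alpha>) < 1" using c \<alpha> by (simp add: field_simps)
    have "q < c * c"
      by (rule less_trans[OF \<open>q < c * \<alpha>\<close>]) (use that c in simp)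
    then have q2: "q * (1 / c)\<^sup>2 < 1"
      using c by (simp add: field_simps power2_eq_square)
    have r: "R < rate (1 / c)"
      unfolding R_def using that c \<alpha> q1 by (intro rate_strict_antimono) (auto simp: field_simps)
    have "f n \<le> 1 / (1 - R / rate (1 / c)) * c ^ n" for n
    proof -
      have "(\<Sum>w\<in>{w \<in> stab S E 0 0. length w = n}. (1 / c) ^ length w) \<le> 1 / (1 - R / rate (1 / c))"
        using c R0 by (intro sum_power_le_of_cogrowth[OF _ q2 r _ cog fin]) auto
      then show ?thesis using c by (simp add: f_def power_divide field_simps)
    qed
    then show ?thesis by blast
  qed
  moreover have "\<not> (\<exists>M. \<forall>n. f n \<le> M * c ^ n)" if c: "0 < c" "c < \<alpha>" for c
  proof
    assume "\<exists>M. \<forall>n. f n \<le> M * c ^ n"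
    then obtain M where M: "\<And>n. f n \<le> M * c ^ n" by blast
    have "sqrt q < \<alpha>" using \<alpha> by (simp add: real_less_lsqrt)
    \<comment> \<open>\<open>c\<close> may be too small for \<open>admissible_insert\<close>, which
      asks for \<open>q < \<sigma>\<^sup>2\<close>; a larger base below \<open>\<alpha>\<close>
      still bounds \<open>f\<close>.\<close>
    then obtain \<sigma> where \<sigma>: "max c (sqrt q) < \<sigma>" "\<sigma> < \<alpha>" using c dense[of "max c (sqrt q)" \<alpha>] by auto
    have \<sigma>0: "0 < \<sigma>" using \<sigma> c by simp
    have "sqrt q * sqrt q < \<sigma> * \<sigma>"
      using \<sigma> \<sigma>0 q_ge_1 by (intro mult_strict_mono) auto
    then have \<sigma>q: "q < \<sigma>\<^sup>2" using q_ge_1 by (simp add: power2_eq_square)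
    have "f n \<le> M * \<sigma> ^ n" for n
    proof -
      have "0 \<le> M" using M[of 0] by (simp add: f_def)
      then have "M * c ^ n \<le> M * \<sigma> ^ n"
        using \<sigma> c by (intro mult_left_mono power_mono) auto
      then show ?thesis using M[of n] by linarith
    qed
    from admissible_insert[OF E[unfolded R_def] \<sigma>q \<sigma>0 \<sigma>(2) this[unfolded f_def]]
    obtain k0 where k0: "\<forall>k\<ge>k0. \<forall>x\<in>block k. \<forall>y\<in>block k. \<forall>s\<in>S - {a}.
        (\<nexists>v. edge E x (s, True) v) \<longrightarrow> (\<nexists>v. edge E y (s, False) v) \<longrightarrow>
        (\<forall>w\<in>stab S E x y. k \<le> length w) \<longrightarrow> admissible R (insert (x, s, y) E)"
      unfolding R_def by (elim exE)
    \<comment> \<open>\<open>(1 / 2) ^ k\<close> is the quotient of the ball bound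
      \<open>(q + 1) ^ k\<close> by the block size \<open>(2 * (q + 1)) ^ k\<close>.\<close>
    have "(q + 1) * (1 - (1 / 2) ^ k) \<le> R" if "k \<ge> k0" for k
    proof -
      let ?N = "real (card (block k))"
      have sat: "\<exists>w\<in>stab S E x y. length w < k"
        if "x \<in> block k" "y \<in> block k" "s \<in> S - {a}"
          "\<nexists>v. edge E x (s, True) v" "\<nexists>v. edge E y (s, False) v" for x y s
      proof (rule ccontr)
        assume "\<not> ?thesis"
        then have "\<forall>w\<in>stab S E x y. k \<le> length w" by (simp add: not_less)
        then have "admissible R (insert (x, s, y) E)"
          using k0 \<open>k \<ge> k0\<close> that by simp
        then have "(x, s, y) \<in> E" using max[of "insert (x, s, y) E"] by blast
        then show False using that(4) by (auto simp: edge_def)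
      qed
      have "(q + 1) * (?N - (q + 1) ^ k) = (\<Sum>l\<in>letters. ?N - (q + 1) ^ k)"
        using card_letters by (simp add: q_def)
      also have "\<dots> \<le> (\<Sum>l\<in>letters. real (card {x \<in> block k. \<exists>y\<in>block k. edge E x l y}))"
        by (intro sum_mono card_saturated_block fold sub sat)
      also have "\<dots> \<le> ?N * R"
        by (intro card_inner_edges_le fold finite_block R0 cog)
      finally have le: "(q + 1) * (?N - (q + 1) ^ k) \<le> ?N * R" .
      have N: "?N = (2 * (q + 1)) ^ k" by (simp add: card_block real_base)
      then have N0: "?N > 0" using q_ge_1 by simp
      have "(q + 1) ^ k = ?N * (1 / 2) ^ k"
        unfolding N power_mult_distrib by (simp add: power_one_over)
      then have "?N * ((q + 1) * (1 - (1 / 2) ^ k)) \<le> ?N * R"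
        using le by (simp add: algebra_simps)
      then show ?thesis using N0 by simp
    qed
    then have "eventually (\<lambda>k. (q + 1) * (1 - (1 / 2) ^ k) \<le> R) sequentially"
      by (auto simp: eventually_sequentially)
    moreover have "(\<lambda>k. (q + 1) * (1 - (1 / 2) ^ k)) \<longlonglongrightarrow> (q + 1) * (1 - 0)"
      by (intro tendsto_intros LIMSEQ_realpow_zero) auto
    ultimately have "q + 1 \<le> R"
      using tendsto_upperbound[of "\<lambda>k. (q + 1) * (1 - (1 / 2) ^ k)" "(q + 1) * (1 - 0)" sequentially R]
      by simp
    \<comment> \<open>As an equation in \<open>\<alpha>\<close>, \<open>R = q + 1\<close> has the
      roots \<open>1\<close> and \<open>q\<close>, and between them \<open>R\<close> is
      smaller.\<close>
    moreover have "R * \<alpha> - (q + 1) * \<alpha> = (\<alpha> - 1) * (\<alpha> - q)"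
      using \<alpha> by (simp add: R field_simps)
    moreover have "(\<alpha> - 1) * (\<alpha> - q) < 0" using \<alpha> by (intro mult_pos_neg) auto
    moreover have "(q + 1) * \<alpha> \<le> R * \<alpha>" using calculation(1) \<alpha> by (intro mult_right_mono) auto
    ultimately show False by linarith
  qed
  ultimately have "exp_rate f \<alpha>" by (simp add: exp_rate_def)
  then show ?thesis using fold unfolding f_def by blast
qed

end

section \<open>Growth rates\<close>

text \<open>The constants in \<open>exp_rate\<close> are invisible to the limsup because their
  \<open>n\<close>-th roots tend to \<open>1\<close>; conversely, finitely many initial terms are
  absorbed into a constant.\<close>

lemma growth_rate_eqI:
  assumes exp: "exp_rate (\<lambda>n. real (growth_fun H n)) \<beta>" and \<beta>: "0 < \<beta>"
  shows "growth_rate H = ereal \<beta>"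
proof (rule antisym)
  let ?f = "\<lambda>n. real (growth_fun H n)"
  show "growth_rate H \<le> ereal \<beta>"
    unfolding growth_rate_def Limsup_le_iff
  proof (intro allI impI)
    fix y assume "ereal \<beta> < y"
    then obtain c where c: "\<beta> < c" "ereal c < y" using ereal_dense2[of "ereal \<beta>" y] by auto
    \<comment> \<open>The gap between \<open>c'\<close> and \<open>c\<close> absorbs the factor
      \<open>root n (max M 1)\<close>, which tends to \<open>1\<close> but may exceed it;
      \<open>max\<close> keeps the constant positive.\<close>
    then obtain c' where c': "\<beta> < c'" "c' < c" using dense by blast
    then obtain M where "\<And>n. ?f n \<le> M * c' ^ n" using exp \<beta> unfolding exp_rate_def by (meson less_trans)
    moreover have "M * c' ^ n \<le> max M 1 * c' ^ n" for n
      using c' \<beta> by (intro mult_right_mono) auto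
    ultimately have M: "?f n \<le> max M 1 * c' ^ n" for n by (meson order_trans)
    have "(\<lambda>n. root n (max M 1) * c') \<longlonglongrightarrow> 1 * c'"
      by (intro tendsto_intros LIMSEQ_root_const) simp
    then have "eventually (\<lambda>n. root n (max M 1) * c' < c) sequentially"
      using c' by (intro order_tendstoD) auto
    then show "eventually (\<lambda>n. ereal (root n (?f n)) < y) sequentially"
      using eventually_gt_at_top[of 0]
    proof eventually_elim
      case (elim n)
      have "root n (?f n) \<le> root n (max M 1 * c' ^ n)"
        using elim M by (intro real_root_le_mono) auto
      also have "\<dots> = root n (max M 1) * c'"
        using elim c' \<beta> by (simp add: real_root_mult real_root_power_cancel)
      finally have "root n (?f n) < c" using elim by simp
      then show ?case using c(2) by (meson ereal_less(2) less_ereal.simps(1) less_trans)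
    qed
  qed
  show "ereal \<beta> \<le> growth_rate H"
  proof (rule ccontr)
    assume "\<not> ereal \<beta> \<le> growth_rate H"
    then obtain c0 where c0: "growth_rate H < ereal c0" "c0 < \<beta>"
      using ereal_dense2[of "growth_rate H" "ereal \<beta>"] by (auto simp: not_le)
    \<comment> \<open>\<open>c0\<close> may fail to be positive, whereas \<open>exp_rate\<close>
      speaks of positive \<open>c\<close>.\<close>
    define c where "c = max c0 (\<beta> / 2)"
    have c: "growth_rate H < ereal c" "0 < c" "c < \<beta>"
      using c0 \<beta> less_le_trans[OF c0(1), of "ereal c"] by (auto simp: c_def)
    from c(1) have "eventually (\<lambda>n. ereal (root n (?f n)) < ereal c) sequentially"
      unfolding growth_rate_def by (rule Limsup_lessD)
    then obtain N where N: "\<And>n. n \<ge> N \<Longrightarrow> root n (?f n) < c"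
      by (auto simp: eventually_sequentially)
    \<comment> \<open>The sum covers the terms up to \<open>N\<close>, the summand \<open>1\<close>
      all later ones.\<close>
    define M where "M = 1 + (\<Sum>n\<le>N. ?f n / c ^ n)"
    have "?f n / c ^ n \<le> M" for n
    proof (cases "n \<le> N")
      case True
      then have "?f n / c ^ n \<le> (\<Sum>n\<le>N. ?f n / c ^ n)"
        using c by (intro member_le_sum) auto
      then show ?thesis by (simp add: M_def)
    next
      case False
      then have "root n (?f n) ^ n \<le> c ^ n"
        using N[of n] by (intro power_mono) auto
      then have "?f n / c ^ n \<le> 1" using False c by simp
      also have "1 \<le> M" using c by (simp add: M_def sum_nonneg)
      finally show ?thesis .
    qed
    then have "\<forall>n. ?f n \<le> M * c ^ n" using c by (simp add: field_simps)
    then show False using exp c unfolding exp_rate_def by blast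
  qed
qed

section \<open>Replacing letters by powers\<close>

definition stretch :: "nat \<Rightarrow> 'a letter list \<Rightarrow> 'a letter list" where
  "stretch L w = concat (map (replicate L) w)"

lemma stretch_Nil [simp]: "stretch L [] = []"
  by (simp add: stretch_def)

lemma stretch_Cons: "stretch L (l # w) = replicate L l @ stretch L w"
  by (simp add: stretch_def)

lemma stretch_append: "stretch L (u @ v) = stretch L u @ stretch L v"
  by (simp add: stretch_def)

lemma length_stretch [simp]: "length (stretch L w) = L * length w"
  by (induction w) (simp_all add: stretch_Cons)

lemma set_stretch: "set (stretch L w) \<subseteq> set w"
  by (auto simp: stretch_def)

lemma foldr_push_cancel: "foldr push_letter (replicate n l) (replicate n (inv_letter l) @ v) = v"
proof (induction n)
  case (Suc n)
  have "replicate (Suc n) l = replicate n l @ [l]" by (simp add: replicate_append_same)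
  then show ?case using Suc by (simp del: replicate.simps add: replicate_Suc)
qed simp

lemma foldr_push_no_cancel:
  "v = [] \<or> hd v \<noteq> inv_letter l \<Longrightarrow> foldr push_letter (replicate n l) v = replicate n l @ v"
proof (induction n)
  case (Suc n)
  have "push_letter l (replicate n l @ v) = l # replicate n l @ v"
    using Suc.prems by (cases n; cases v) auto
  then show ?case using Suc by simp
qed simp

text \<open>Adjacent runs of the common length \<open>L\<close> either cancel completely, when their
  letters are inverse, or not at all.\<close>

lemma reduce_word_stretch:
  assumes "L > 0"
  shows "reduce_word (stretch L w) = stretch L (reduce_word w)"
proof (induction w)
  case (Cons l w)
  have "reduce_word (stretch L (l # w)) = foldr push_letter (replicate L l) (stretch L (reduce_word w))"
    by (simp add: stretch_Cons reduce_word_append Cons)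
  also have "\<dots> = stretch L (push_letter l (reduce_word w))"
  proof (cases "reduce_word w")
    case Nil
    then show ?thesis by (simp add: foldr_push_no_cancel stretch_Cons del: foldr_replicate)
  next
    case (Cons m u)
    have "hd (stretch L (m # u)) = m" using assms by (cases L) (auto simp: stretch_Cons)
    then show ?thesis
      using Cons foldr_push_no_cancel[of "stretch L (m # u)" l L] foldr_push_cancel[of L l "stretch L u"]
      by (auto simp: stretch_Cons simp del: foldr_replicate)
  qed
  finally show ?case by (simp add: reduce_word_Cons)
qed simp

lemma inj_stretch:
  assumes "L > 0"
  shows "inj (stretch L)"
proof (rule injI)
  fix u v :: "'a letter list"
  assume "stretch L u = stretch L v"
  then show "u = v"
  proof (induction u arbitrary: v)
    case Nil
    then have "length (stretch L v) = 0" by simp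
    then show ?case using assms by simp
  next
    case (Cons l u)
    have "length (stretch L (l # u)) = length (stretch L v)" using Cons.prems by simp
    then obtain m v' where v: "v = m # v'" using assms by (cases v) auto
    have "replicate L l = replicate L m" "stretch L u = stretch L v'"
      using Cons.prems v by (simp_all add: stretch_Cons)
    then show ?case using Cons.IH v assms by (cases L) auto
  qed
qed

lemma subgroup_stretch:
  assumes "L > 0" "subgroup H (free_group S)"
  shows "subgroup (stretch L ` H) (free_group S)"
proof -
  have "stretch L \<in> hom (free_group S) (free_group S)"
  proof (rule homI)
    fix u assume "u \<in> carrier (free_group S)"
    moreover from this have "reduced (stretch L u)"
      using reduced_reduce_word[of "stretch L u"]
      by (simp add: reduce_word_stretch[OF assms(1)] free_group_def reduce_word_id)
    ultimately show "stretch L u \<in> carrier (free_group S)"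
      using set_stretch[of L u] by (auto simp: free_group_def)
  next
    fix u v
    show "stretch L (u \<otimes>\<^bsub>free_group S\<^esub> v) = stretch L u \<otimes>\<^bsub>free_group S\<^esub> stretch L v"
      by (simp add: free_group_def reduce_word_stretch[OF assms(1), symmetric] stretch_append)
  qed
  then interpret group_hom "free_group S" "free_group S" "stretch L"
    by (simp add: group_hom_def group_hom_axioms_def group_free_group)
  show ?thesis using assms(2) by (rule subgroup_img_is_subgroup)
qed

lemma growth_fun_stretch:
  assumes "L > 0"
  shows "growth_fun (stretch L ` H) (L * n) = growth_fun H n"
proof -
  have "{h \<in> stretch L ` H. word_length h = L * n} = stretch L ` {h \<in> H. word_length h = n}"
    using assms by (auto simp: word_length_def)
  then show ?thesis
    using card_image[OF inj_on_subset[OF inj_stretch[OF assms]]] by (simp add: growth_fun_def)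
qed

lemma growth_fun_stretch_zero: "\<not> L dvd m \<Longrightarrow> growth_fun (stretch L ` H) m = 0"
proof -
  assume "\<not> L dvd m"
  then have "{h \<in> stretch L ` H. word_length h = m} = {}" by (auto simp: word_length_def)
  then show ?thesis unfolding growth_fun_def by (simp only: card.empty)
qed

text \<open>All lengths are multiplied by \<open>L\<close> and no element of another length arises,
  so the growth rate becomes its \<open>L\<close>-th root.\<close>

lemma exp_rate_stretch:
  assumes L: "L > 0" and \<beta>: "\<beta> > 0"
    and exp: "exp_rate (\<lambda>n. real (growth_fun H n)) (\<beta> ^ L)"
  shows "exp_rate (\<lambda>n. real (growth_fun (stretch L ` H) n)) \<beta>"
  unfolding exp_rate_def
proof (intro allI impI conjI)
  fix c :: real
  assume c: "0 < c" "\<beta> < c"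
  then have "\<beta> ^ L < c ^ L" using L \<beta> by (intro power_strict_mono) auto
  then obtain M where M: "\<And>n. real (growth_fun H n) \<le> M * (c ^ L) ^ n"
    using exp c unfolding exp_rate_def by (meson zero_less_power)
  have "M \<ge> 0" using order_trans[OF _ M[of 0]] by simp
  have "real (growth_fun (stretch L ` H) m) \<le> M * c ^ m" for m
  proof (cases "L dvd m")
    case True
    then obtain n where "m = L * n" by blast
    then show ?thesis using M[of n] by (simp add: growth_fun_stretch[OF L] power_mult)
  next
    case False
    then show ?thesis using \<open>M \<ge> 0\<close> c by (simp add: growth_fun_stretch_zero)
  qed
  then show "\<exists>M. \<forall>n. real (growth_fun (stretch L ` H) n) \<le> M * c ^ n" by blast
next
  fix c :: real
  assume c: "0 < c" "c < \<beta>"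
  then have cL: "c ^ L < \<beta> ^ L" "0 < c ^ L" using L by (auto intro: power_strict_mono)
  show "\<not> (\<exists>M. \<forall>n. real (growth_fun (stretch L ` H) n) \<le> M * c ^ n)"
  proof
    assume "\<exists>M. \<forall>n. real (growth_fun (stretch L ` H) n) \<le> M * c ^ n"
    then obtain M where M: "\<And>n. real (growth_fun (stretch L ` H) n) \<le> M * c ^ n" by blast
    have "real (growth_fun H n) \<le> M * (c ^ L) ^ n" for n
      using M[of "L * n"] by (simp add: growth_fun_stretch[OF L] power_mult)
    then show False using exp cL unfolding exp_rate_def by blast
  qed
qed

section \<open>The growth rates of a cyclic group and of the whole group\<close>

lemma exp_rateI_bounds:
  assumes \<beta>: "\<beta> > 0" and bounds: "\<And>n. \<beta> ^ n \<le> f n" "\<And>n. f n \<le> K * \<beta> ^ n"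
  shows "exp_rate f \<beta>"
  unfolding exp_rate_def
proof (intro allI impI conjI)
  fix c :: real
  assume c: "0 < c" "\<beta> < c"
  have "0 \<le> K" using bounds[of 0] by simp
  then have "K * \<beta> ^ n \<le> K * c ^ n" for n
    using c \<beta> by (intro mult_left_mono power_mono) auto
  then show "\<exists>M. \<forall>n. f n \<le> M * c ^ n" using bounds(2) by (meson order_trans)
next
  fix c :: real
  assume c: "0 < c" "c < \<beta>"
  show "\<not> (\<exists>M. \<forall>n. f n \<le> M * c ^ n)"
  proof
    assume "\<exists>M. \<forall>n. f n \<le> M * c ^ n"
    then obtain M where M: "\<And>n. f n \<le> M * c ^ n" by blast
    have "(\<beta> / c) ^ n \<le> M" for n
      using order_trans[OF bounds(1) M, of n] c by (simp add: power_divide field_simps)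
    then have "\<beta> / c \<le> 1" by (rule le_one_if_powers_bounded)
    then show False using c by simp
  qed
qed

text \<open>A single loop labelled \<open>a\<close> is the Stallings graph of the cyclic group
  generated by \<open>a\<close>, whose elements of length \<open>n\<close> are the powers with
  exponents \<open>n\<close> and \<open>-n\<close>.\<close>

lemma exp_rate_cyclic:
  assumes "a \<in> S"
  shows "exp_rate (\<lambda>n. real (growth_fun (stab S {((), a, ())} () ()) n)) 1"
proof (rule exp_rateI_bounds[where K = 2])
  let ?H = "stab S {((), a, ())} () ()"
  have walk: "walk {((), a, ())} () w () \<longleftrightarrow> (\<forall>l\<in>set w. fst l = a)" for w
    by (induction w) (auto simp: edge_def)
  have sub: "{h \<in> ?H. word_length h = n} \<subseteq> {replicate n (a, True), replicate n (a, False)}" for n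
  proof
    fix h assume h: "h \<in> {h \<in> ?H. word_length h = n}"
    then have "reduced h" "\<And>l. l \<in> set h \<Longrightarrow> fst l = a" by (auto simp: stab_def walk)
    from reduced_single_generator[OF this] obtain m c where m: "h = replicate m (a, c)" by blast
    then have "m = n" using h by (simp add: word_length_def)
    then show "h \<in> {replicate n (a, True), replicate n (a, False)}" using m by (cases c) auto
  qed
  have "reduced (replicate n (a, True))" for n
    by (induction n) (auto simp: reduced_Cons inv_letter_def)
  then have mem: "replicate n (a, True) \<in> {h \<in> ?H. word_length h = n}" for n
    using assms by (auto simp: stab_def walk word_length_def)
  fix n
  have fin: "finite {h \<in> ?H. word_length h = n}" using sub by (rule finite_subset) simp
  then have "growth_fun ?H n > 0" unfolding growth_fun_def using mem[of n] by (auto simp: card_gt_0_iff)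
  then show "1 ^ n \<le> real (growth_fun ?H n)" by simp
  have "card {h \<in> ?H. word_length h = n} \<le> card {replicate n (a, True), replicate n (a, False)}"
    using sub by (rule card_mono[rotated]) simp
  also have "\<dots> \<le> 2" by (simp add: card_insert_if)
  finally show "real (growth_fun ?H n) \<le> 2 * 1 ^ n" by (simp add: growth_fun_def)
qed simp

context free_alphabet begin

text \<open>Any letter but the inverse of its head may be put in front of a nonempty reduced word;
  the index \<open>Suc n\<close> keeps the empty word, which has \<open>q + 1\<close> extensions,
  apart.\<close>

lemma card_sphere:
  "real (growth_fun (carrier (free_group S)) (Suc n)) = (q + 1) * q ^ n"
proof -
  define B where "B n = {w. reduced w \<and> set w \<subseteq> letters \<and> length w = n}" for n
  have finB: "finite (B n)" for n
    by (rule finite_subset[OF _ finite_length_le[of n]]) (auto simp: B_def)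
  have "real (card (B (Suc n))) = (q + 1) * q ^ n"
  proof (induction n)
    case 0
    have "B (Suc 0) = (\<lambda>l. [l]) ` letters"
      by (auto simp: B_def reduced_Cons length_Suc_conv)
    then have "card (B (Suc 0)) = card letters" by (simp add: card_image inj_on_def)
    then show ?case using card_letters by (simp add: q_def)
  next
    case (Suc n)
    let ?P = "SIGMA w:B (Suc n). letters - {inv_letter (hd w)}"
    have "B (Suc (Suc n)) = (\<lambda>(w, l). l # w) ` ?P"
    proof (intro equalityI subsetI)
      fix w assume "w \<in> B (Suc (Suc n))"
      then obtain l u where w: "w = l # u" "reduced (l # u)" "set (l # u) \<subseteq> letters" "length u = Suc n"
        by (auto simp: B_def length_Suc_conv)
      then have "u \<noteq> []" by auto
      then have "(u, l) \<in> ?P" using w by (auto simp: B_def reduced_Cons)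
      then show "w \<in> (\<lambda>(w, l). l # w) ` ?P" using w(1) by force
    next
      fix w assume "w \<in> (\<lambda>(w, l). l # w) ` ?P"
      then obtain u l where "w = l # u" "u \<in> B (Suc n)" "l \<in> letters" "l \<noteq> inv_letter (hd u)" by auto
      then show "w \<in> B (Suc (Suc n))" by (auto simp: B_def reduced_Cons)
    qed
    moreover have "inj_on (\<lambda>(w, l). l # w) ?P" by (auto simp: inj_on_def)
    ultimately have "card (B (Suc (Suc n))) = card ?P" by (simp add: card_image)
    also have "\<dots> = (\<Sum>w\<in>B (Suc n). card (letters - {inv_letter (hd w)}))"
      using finB finite_letters by (intro card_SigmaI) auto
    also have "\<dots> = (\<Sum>w\<in>B (Suc n). card letters - 1)"
    proof (rule sum.cong[OF refl])
      fix w assume "w \<in> B (Suc n)"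
      then have "hd w \<in> letters" by (cases w) (auto simp: B_def)
      then show "card (letters - {inv_letter (hd w)}) = card letters - 1"
        by (intro card_Diff_singleton) simp
    qed
    finally have "card (B (Suc (Suc n))) = card (B (Suc n)) * (card letters - 1)" by simp
    moreover have "real (card letters - 1) = q"
      using q_ge_1 card_letters by (simp add: q_def of_nat_diff)
    ultimately show ?case using Suc by simp
  qed
  moreover have "{h \<in> carrier (free_group S). word_length h = Suc n} = B (Suc n)"
    by (auto simp: free_group_def word_length_def B_def)
  ultimately show ?thesis by (simp add: growth_fun_def)
qed

lemma exp_rate_carrier: "exp_rate (\<lambda>n. real (growth_fun (carrier (free_group S)) n)) q"
proof (rule exp_rateI_bounds[where K = 2])
  fix n
  have "{h \<in> carrier (free_group S). word_length h = 0} = {[]}"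
    by (auto simp: free_group_def word_length_def)
  then have zero: "growth_fun (carrier (free_group S)) 0 = 1" by (simp add: growth_fun_def)
  show "q ^ n \<le> real (growth_fun (carrier (free_group S)) n)"
    using q_ge_1 by (cases n) (auto simp: zero card_sphere intro!: mult_right_mono)
  have "(q + 1) * q ^ m \<le> 2 * q * q ^ m" for m
    using q_ge_1 by (intro mult_right_mono) auto
  then show "real (growth_fun (carrier (free_group S)) n) \<le> 2 * q ^ n"
    using q_ge_1 by (cases n) (auto simp: zero card_sphere)
qed (use q_ge_1 in simp)

text \<open>Some power \<open>\<beta> = \<alpha> ^ L\<close> falls into the range above
  \<open>sqrt q\<close> and up to \<open>q\<close>; a subgroup of rate \<open>\<beta>\<close> is
  then stretched by \<open>L\<close>.\<close>

lemma ex_subgroup_exp_rate: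
  assumes \<alpha>: "1 < \<alpha>" "\<alpha> \<le> q"
  shows "\<exists>H. subgroup H (free_group S) \<and> exp_rate (\<lambda>n. real (growth_fun H n)) \<alpha>"
proof -
  obtain m where m: "q < \<alpha> ^ m" using real_arch_pow[OF \<alpha>(1)] by blast
  \<comment> \<open>\<open>k - 1\<close> becomes \<open>L\<close>, the last exponent with
    \<open>\<alpha> ^ L \<le> q\<close>. From \<open>\<alpha> \<le> q\<close> follows
    \<open>k \<ge> 2\<close>, so \<open>L > 0\<close>, and then \<open>k \<le> 2 * L\<close> yields
    \<open>q < \<beta>\<^sup>2\<close>.\<close>
  define k where "k = (LEAST n. q < \<alpha> ^ n)"
  have k: "q < \<alpha> ^ k" and least: "\<And>n. n < k \<Longrightarrow> \<alpha> ^ n \<le> q"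
    unfolding k_def using m by (auto intro: LeastI dest: not_less_Least simp: not_less)
  have "k \<noteq> 0" using k q_ge_1 by (cases k) auto
  moreover have "k \<noteq> 1" using k \<alpha> by auto
  ultimately obtain L where L: "k = Suc L" "L > 0" by (cases k) auto
  define \<beta> where "\<beta> = \<alpha> ^ L"
  have \<beta>: "1 < \<beta>" "\<beta> \<le> q"
    using \<alpha> L least[of L] by (auto simp: \<beta>_def one_less_power)
  have "\<alpha> ^ k \<le> \<alpha> ^ (L * 2)" using \<alpha> L by (intro power_increasing) auto
  then have \<beta>2: "q < \<beta>\<^sup>2" using k by (simp add: \<beta>_def power_mult)
  have "\<exists>H. subgroup H (free_group S) \<and> exp_rate (\<lambda>n. real (growth_fun H n)) \<beta>"
  proof (cases "\<beta> = q")
    case True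
    then show ?thesis
      using exp_rate_carrier group.subgroup_self[OF group_free_group] by blast
  next
    case False
    obtain a where "a \<in> S" using nonempty_S by blast
    then interpret line_alphabet S a by unfold_locales
    obtain E :: "(int \<times> 'a \<times> int) set" where
      "folded E" "exp_rate (\<lambda>n. real (card {w \<in> stab S E 0 0. length w = n})) \<beta>"
      using ex_folded_exp_rate[OF \<beta>2 \<beta>(1)] False \<beta>(2) by auto
    then show ?thesis
      using subgroup_stab[of E S 0]
      by (intro exI[of _ "stab S E 0 0"]) (simp add: growth_fun_def word_length_def)
  qed
  then obtain H where "subgroup H (free_group S)" "exp_rate (\<lambda>n. real (growth_fun H n)) \<beta>" by blast
  then show ?thesis
    using subgroup_stretch[OF L(2), of H S] exp_rate_stretch[OF L(2), of \<alpha> H] \<alpha>(1)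
    unfolding \<beta>_def by (intro exI[of _ "stretch L ` H"]) simp
qed

end

theorem theorem1p1:
  fixes S :: "'a set" and r :: nat and \<alpha> :: real
  assumes "r \<ge> 2"
    and "finite S" and "card S = r"
    and "1 \<le> \<alpha>" and "\<alpha> \<le> 2 * real r - 1"
  shows "\<exists>H. subgroup H (free_group S) \<and> growth_rate H = ereal \<alpha>"
proof -
  have "S \<noteq> {}" using assms by auto
  then interpret free_alphabet S using assms(2) by unfold_locales
  have "\<exists>H. subgroup H (free_group S) \<and> exp_rate (\<lambda>n. real (growth_fun H n)) \<alpha>"
  proof (cases "\<alpha> = 1")
    \<comment> \<open>No power of \<open>1\<close> exceeds \<open>q\<close>, so an exponent cannot
      be chosen as in \<open>ex_subgroup_exp_rate\<close>; a cyclic subgroup attains the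
      rate.\<close>
    case True
    obtain a where "a \<in> S" using nonempty_S by blast
    moreover have "folded {((), a, ())}" by (simp add: folded_def)
    ultimately show ?thesis
      using True exp_rate_cyclic subgroup_stab[of "{((), a, ())}" S "()"]
      by (intro exI[of _ "stab S {((), a, ())} () ()"]) simp
  next
    case False
    then show ?thesis using assms by (intro ex_subgroup_exp_rate) (auto simp: q_def)
  qed
  then obtain H where "subgroup H (free_group S)" "exp_rate (\<lambda>n. real (growth_fun H n)) \<alpha>"
    by blast
  then show ?thesis
    using growth_rate_eqI[of H \<alpha>] assms(4) by (intro exI[of _ H]) simp
qed

end
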